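(* Let $(X,d)$ be a compact metric space and let $f\colon X\to X$ be a continuous map with the shadowing property. Then exactly one of the following conditions holds: (1) $h_{\mathrm{top}}(f)>0$, $I(f)\neq\emptyset$, and $I(f)$ has full entropy, i.e. $h_{\mathrm{top}}(f,I(f))=h_{\mathrm{top}}(f)$; (2) $h_{\mathrm{top}}(f)=0$ and $I(f)=\emptyset$.
   Context: Shadowing: a sequence $\{x_n\}_{n\ge 0}\subset X$ is a $\delta$-pseudo-orbit of $f$ if $d(f(x_n),x_{n+1})<\delta$ for all $n\ge 0$; it is $\varepsilon$-shadowed by the orbit of $y\in X$ if $d(f^n(y),x_n)<\varepsilon$ for all $n\ge 0$. The map $f$ has the shadowing property if for every $\varepsilon>0$ there is $\delta>0$ such that every $\delta$-pseudo-orbit is $\varepsilon$-shadowed by some orbit. Irregular set: for continuous $\varphi\colon X\to\mathbb{R}$, $I_\varphi(f)$ is the set of $x\in X$ for which $\frac1n\sum_{i=0}^{n-1}\varphi(f^i(x))$ does not converge as $n\to\infty$; $I(f)=\bigcup_{\varphi\in C(X,\mathbb{R})}I_\varphi(f)$. Entropy: $h_{\mathrm{top}}(f)$ is the usual topological entropy of $f$ (possibly $+\infty$). For an arbitrary subset $E\subset X$, $h_{\mathrm{top}}(f,E)$ is Bowen's topological entropy, defined as follows. Let $d_n(x,y)=\max_{0\le i\le n-1}d(f^i(x),f^i(y))$ and $B_n(x,\varepsilon)=\{y\in X: d_n(x,y)<\varepsilon\}$. Let $\mathcal{G}_n(E,\varepsilon)$ be the collection of all finite or countable covers of $E$ by sets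 of the form $B_u(x,\varepsilon)$ with $u\ge n$. Put $C(E;t,n,\varepsilon,f)=\inf_{\mathcal{C}\in\mathcal{G}_n(E,\varepsilon)}\sum_{B_u(x,\varepsilon)\in\mathcal{C}}e^{-tu}$, $C(E;t,\varepsilon,f)=\lim_{n\to\infty}C(E;t,n,\varepsilon,f)$, $h_{\mathrm{top}}(E;\varepsilon,f)=\inf\{t: C(E;t,\varepsilon,f)=0\}=\sup\{t:C(E;t,\varepsilon,f)=\infty\}$, and $h_{\mathrm{top}}(f,E)=\lim_{\varepsilon\to0^+}h_{\mathrm{top}}(E;\varepsilon,f)$. *)

theory Defs
  imports "HOL-Analysis.Analysis"
begin

text \<open>A compact metric space is a type of class \<open>metric_space\<close> whose universe is
  compact; the dynamics is a self-map \<open>f\<close> of that type.\<close>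

subsection \<open>Shadowing\<close>

definition pseudo_orbit :: "('a::metric_space \<Rightarrow> 'a) \<Rightarrow> real \<Rightarrow> (nat \<Rightarrow> 'a) \<Rightarrow> bool" where
  "pseudo_orbit f \<delta> x \<longleftrightarrow> (\<forall>n. dist (f (x n)) (x (Suc n)) < \<delta>)"

definition shadowed_by :: "('a::metric_space \<Rightarrow> 'a) \<Rightarrow> real \<Rightarrow> (nat \<Rightarrow> 'a) \<Rightarrow> 'a \<Rightarrow> bool" where
  "shadowed_by f \<epsilon> x y \<longleftrightarrow> (\<forall>n. dist ((f ^^ n) y) (x n) < \<epsilon>)"

definition has_shadowing :: "('a::metric_space \<Rightarrow> 'a) \<Rightarrow> bool" where
  "has_shadowing f \<longleftrightarrow>
     (\<forall>\<epsilon>>0. \<exists>\<delta>>0. \<forall>x. pseudo_orbit f \<delta> x \<longrightarrow> (\<exists>y. shadowed_by f \<epsilon> x y))"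

subsection \<open>Irregular points\<close>

definition irregular_for :: "('a::metric_space \<Rightarrow> 'a) \<Rightarrow> ('a \<Rightarrow> real) \<Rightarrow> 'a set" where
  "irregular_for f \<phi> = {x. \<not> convergent (\<lambda>n. (\<Sum>i<n. \<phi> ((f ^^ i) x)) / real n)}"

definition irregular_set :: "('a::metric_space \<Rightarrow> 'a) \<Rightarrow> 'a set" where
  "irregular_set f = (\<Union>\<phi>\<in>{\<phi>. continuous_on UNIV \<phi>}. irregular_for f \<phi>)"

subsection \<open>Bowen metrics\<close>

text \<open>Meaningful for \<open>n \<ge> 1\<close> only (the maximum over the empty set is unspecified). All uses
  below are under a limit \<open>n \<rightarrow> \<infinity>\<close>, which does not see \<open>n = 0\<close>.\<close>

definition bowen_dist :: "('a::metric_space \<Rightarrow> 'a) \<Rightarrow> nat \<Rightarrow> 'a \<Rightarrow> 'a \<Rightarrow> real" where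
  "bowen_dist f n x y = (MAX i\<in>{..<n}. dist ((f ^^ i) x) ((f ^^ i) y))"

definition bowen_ball :: "('a::metric_space \<Rightarrow> 'a) \<Rightarrow> nat \<Rightarrow> 'a \<Rightarrow> real \<Rightarrow> 'a set" where
  "bowen_ball f n x \<epsilon> = {y. bowen_dist f n x y < \<epsilon>}"

subsection \<open>Topological entropy of the system\<close>

definition separated :: "('a::metric_space \<Rightarrow> 'a) \<Rightarrow> nat \<Rightarrow> real \<Rightarrow> 'a set \<Rightarrow> bool" where
  "separated f n \<epsilon> A \<longleftrightarrow> (\<forall>x\<in>A. \<forall>y\<in>A. x \<noteq> y \<longrightarrow> bowen_dist f n x y > \<epsilon>)"

text \<open>The Bowen--Dinaburg definition: the limit as \<open>\<epsilon> \<rightarrow> 0+\<close> of the exponential growth rate of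
  the maximal cardinality \<open>s\<^sub>n(\<epsilon>)\<close> of an \<open>(n, \<epsilon>)\<close>-separated set. The supremum is \<open>(log s\<^sub>n(\<epsilon>)) / n\<close>.\<close>

definition htop_eps :: "('a::metric_space \<Rightarrow> 'a) \<Rightarrow> real \<Rightarrow> ereal" where
  "htop_eps f \<epsilon> =
     limsup (\<lambda>n. SUP A\<in>{A. finite A \<and> A \<noteq> {} \<and> separated f n \<epsilon> A}.
                    ereal (ln (real (card A)) / real n))"

definition htop :: "('a::metric_space \<Rightarrow> 'a) \<Rightarrow> ereal" where
  "htop f = Lim (at_right 0) (\<lambda>\<epsilon>. htop_eps f \<epsilon>)"

subsection \<open>Bowen's topological entropy of a subset\<close>

text \<open>A cover is encoded by the set of pairs \<open>(u, x)\<close> indexing its balls \<open>B\<^sub>u(x, \<epsilon>)\<close>: the weight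
  \<open>exp (- t u)\<close> depends on \<open>u\<close>, which the ball, as a set of points, does not determine.\<close>

definition bowen_covers ::
    "('a::metric_space \<Rightarrow> 'a) \<Rightarrow> 'a set \<Rightarrow> nat \<Rightarrow> real \<Rightarrow> (nat \<times> 'a) set set" where
  "bowen_covers f E n \<epsilon> =
     {P. countable P \<and> (\<forall>(u, x)\<in>P. u \<ge> n) \<and> E \<subseteq> (\<Union>(u, x)\<in>P. bowen_ball f u x \<epsilon>)}"

definition bowen_C_n ::
    "('a::metric_space \<Rightarrow> 'a) \<Rightarrow> 'a set \<Rightarrow> real \<Rightarrow> nat \<Rightarrow> real \<Rightarrow> ennreal" where
  "bowen_C_n f E t n \<epsilon> =
     (INF P\<in>bowen_covers f E n \<epsilon>. \<Sum>\<^sub>\<infinity>(u, x)\<in>P. ennreal (exp (- t * real u)))"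

definition bowen_C :: "('a::metric_space \<Rightarrow> 'a) \<Rightarrow> 'a set \<Rightarrow> real \<Rightarrow> real \<Rightarrow> ennreal" where
  "bowen_C f E t \<epsilon> = lim (\<lambda>n. bowen_C_n f E t n \<epsilon>)"

text \<open>The infimum is taken in the extended reals, so it is \<open>\<infinity>\<close> if no \<open>t\<close> qualifies. All real \<open>t\<close>
  are admitted; for nonempty \<open>E\<close> no \<open>t \<le> 0\<close> qualifies, as every covering sum is then at least 1.\<close>

definition htop_on_eps :: "('a::metric_space \<Rightarrow> 'a) \<Rightarrow> 'a set \<Rightarrow> real \<Rightarrow> ereal" where
  "htop_on_eps f E \<epsilon> = Inf (ereal ` {t. bowen_C f E t \<epsilon> = 0})"

definition htop_on :: "('a::metric_space \<Rightarrow> 'a) \<Rightarrow> 'a set \<Rightarrow> ereal" where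
  "htop_on f E = Lim (at_right 0) (\<lambda>\<epsilon>. htop_on_eps f E \<epsilon>)"

end

theory Submission
  imports Defs
begin

text \<open>
  The argument counts finite sets of orbit segments. The space is divided into finitely many
  cells of small diameter, given by a function \<open>\<kappa>\<close> of finite range, and a loop is a
  pseudo-orbit segment that starts in a cell and whose last point is mapped back into that cell.
  Loops of equal length at the same cell can be concatenated in any order, and every concatenation is a
  pseudo-orbit, hence shadowed by a true orbit.

  An irregular point forces positive entropy: along its orbit some Birkhoff average keeps
  dropping below \<open>\<alpha>\<close> and rising above \<open>\<beta> > \<alpha>\<close>, so two loops of equal length at one cell can
  be cut out of the orbit whose averages stay on different sides of a gap. They are therefore
  some definite distance apart at some time, and shadowing all words in the two loops gives
  exponentially many separated points (\<open>htop_pos_of_irregular\<close>).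

  Conversely, let \<open>h\<close> be below the entropy of \<open>f\<close>. Cutting an orbit segment at the last visit to its first cell, then
  at the last visit to the next cell, and so on, breaks it into at most as many loops as there are cells.
  So the exponential growth of separated orbit segments must already be present among the loops of some length
  \<open>l\<close> at a single cell (\<open>loops_of_positive_entropy\<close>). There are then more than \<open>l\<close> such
  loops, and since a loop has only \<open>l\<close> cyclic rotations, two of them, \<open>a\<close> and \<open>b\<close>, are so different that no orbit
  follows both of them periodically, whatever the phases (\<open>disjoint_cyclic_tracers\<close>); a
  continuous function takes the values 0 and 1 on the two sets of periodic followers. Now let the loops be chosen freely,
  except on a sparse sequence of stretches, each as long as a fixed small proportion of its starting
  time, that consist alternately of repetitions of \<open>a\<close> and of \<open>b\<close>. A convergent Birkhoff average would have a limit of at most \<open>1/4\<close>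
  because of the \<open>a\<close>-stretches and of at least \<open>3/4\<close> because of the \<open>b\<close>-stretches, so all points that shadow such
  sequences are irregular. The stretches take up little of the freedom of choice, so
  counting words shows that the entropy of this compact set of points is at least
  \<open>h\<close> (\<open>sum_cover_ge\<close>, \<open>irregular_entropy_ge\<close>).

  That no set has larger Bowen entropy than the whole system follows by covering it with the Bowen balls around a
  maximal separated set (\<open>htop_on_eps_le_htop\<close>).
\<close>

section \<open>Separated sets and the two entropies\<close>

text \<open>For \<open>n > 0\<close> this is \<open>separated\<close>. For \<open>n = 0\<close> it allows one point at most, whereas
\<open>bowen_dist f 0\<close> is unspecified; inductions on the length of orbit segments start at 0.\<close>
definition separated_points :: "('a::metric_space \<Rightarrow> 'a) \<Rightarrow> nat \<Rightarrow> real \<Rightarrow> 'a set \<Rightarrow> bool" where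
  "separated_points f n e A \<longleftrightarrow>
     (\<forall>x\<in>A. \<forall>y\<in>A. x \<noteq> y \<longrightarrow> (\<exists>i<n. e < dist ((f ^^ i) x) ((f ^^ i) y)))"

lemma bowen_dist_less_iff:
  assumes "0 < n"
  shows "bowen_dist f n x y < e \<longleftrightarrow> (\<forall>i<n. dist ((f ^^ i) x) ((f ^^ i) y) < e)"
  unfolding bowen_dist_def using assms by (subst Max_less_iff) auto

lemma less_bowen_dist_iff:
  assumes "0 < n"
  shows "e < bowen_dist f n x y \<longleftrightarrow> (\<exists>i<n. e < dist ((f ^^ i) x) ((f ^^ i) y))"
  unfolding bowen_dist_def using assms by (subst Max_gr_iff) auto

lemma separated_iff_separated_points:
  "0 < n \<Longrightarrow> separated f n e A \<longleftrightarrow> separated_points f n e A"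
  unfolding separated_def separated_points_def by (simp add: less_bowen_dist_iff)

lemma continuous_on_funpow:
  fixes f :: "'a::topological_space \<Rightarrow> 'a"
  assumes "continuous_on UNIV f" shows "continuous_on UNIV (f ^^ i)"
  by (induction i) (auto intro!: continuous_intros continuous_on_compose2[OF assms])

lemma bowen_ball_open:
  fixes f :: "'a::metric_space \<Rightarrow> 'a"
  assumes "continuous_on UNIV f" "0 < n"
  shows "open (bowen_ball f n x e)"
proof -
  have "bowen_ball f n x e = (\<Inter>i\<in>{..<n}. {y. dist ((f ^^ i) x) ((f ^^ i) y) < e})"
    using assms(2) by (auto simp: bowen_ball_def bowen_dist_less_iff)
  moreover have "open {y. dist ((f ^^ i) x) ((f ^^ i) y) < e}" for i
    by (intro open_Collect_less continuous_intros continuous_on_funpow assms(1))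
  ultimately show ?thesis by (auto intro!: open_INT)
qed

text \<open>Both entropies are limits of quantities that grow as the scale shrinks, so the limits are suprema.\<close>
lemma Lim_at_right_antimono:
  fixes g :: "real \<Rightarrow> ereal"
  assumes "\<And>x y. 0 < x \<Longrightarrow> x \<le> y \<Longrightarrow> g y \<le> g x"
  shows "Lim (at_right 0) g = (SUP x\<in>{0<..}. g x)"
proof (rule tendsto_Lim)
  show "(g \<longlongrightarrow> (SUP x\<in>{0<..}. g x)) (at_right 0)"
  proof (rule order_tendstoI)
    fix a assume "a < (SUP x\<in>{0<..}. g x)"
    then obtain x where x: "0 < x" "a < g x" by (auto simp: less_SUP_iff)
    then have "\<forall>y>0. y < x \<longrightarrow> a < g y"
      using assms by (meson less_eq_real_def less_le_trans)
    then show "\<forall>\<^sub>F y in at_right 0. a < g y"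
      using x by (auto simp: eventually_at_right_field)
  next
    fix a assume a: "(SUP x\<in>{0<..}. g x) < a"
    have "g y < a" if "0 < y" for y
      using a that by (meson SUP_upper greaterThan_iff le_less_trans)
    then show "\<forall>\<^sub>F y in at_right 0. g y < a"
      by (auto simp: eventually_at_right_field intro!: exI[of _ 1])
  qed
qed simp

lemma htop_eps_antimono: "e \<le> e' \<Longrightarrow> htop_eps f e' \<le> htop_eps f e"
  unfolding htop_eps_def
  by (intro Limsup_mono always_eventually allI SUP_subset_mono)
     (auto simp: separated_def dest: le_less_trans)

lemma htop_eq_SUP: "htop f = (SUP e\<in>{0<..}. htop_eps f e)"
  unfolding htop_def by (intro Lim_at_right_antimono htop_eps_antimono)

lemma bowen_covers_mono: "n \<le> n' \<Longrightarrow> E \<subseteq> E' \<Longrightarrow> bowen_covers f E' n' e \<subseteq> bowen_covers f E n e"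
proof
  fix P assume "n \<le> n'" "E \<subseteq> E'" and P: "P \<in> bowen_covers f E' n' e"
  have "\<forall>(u, x)\<in>P. n \<le> u"
    using P \<open>n \<le> n'\<close> by (auto simp: bowen_covers_def dest!: bspec)
  then show "P \<in> bowen_covers f E n e"
    using P subset_trans[OF \<open>E \<subseteq> E'\<close>] unfolding bowen_covers_def by blast
qed

lemma bowen_covers_mono_radius:
  assumes "e \<le> e'" shows "bowen_covers f E n e \<subseteq> bowen_covers f E n e'"
proof -
  have "bowen_ball f u x e \<subseteq> bowen_ball f u x e'" for u x
    using assms by (auto simp: bowen_ball_def)
  then have "(\<Union>(u, x)\<in>P. bowen_ball f u x e) \<subseteq> (\<Union>(u, x)\<in>P. bowen_ball f u x e')" for P
    by (intro UN_mono) auto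
  then show ?thesis unfolding bowen_covers_def by (intro Collect_mono) (meson subset_trans)
qed

lemma bowen_C_eq_SUP: "bowen_C f E t e = (SUP n. bowen_C_n f E t n e)"
proof -
  have "incseq (\<lambda>n. bowen_C_n f E t n e)"
    unfolding bowen_C_n_def
    by (intro monoI INF_superset_mono bowen_covers_mono) auto
  then show ?thesis
    unfolding bowen_C_def by (metis LIMSEQ_SUP limI)
qed

lemma htop_on_eps_antimono:
  assumes "e \<le> e'" shows "htop_on_eps f E e' \<le> htop_on_eps f E e"
proof -
  have "bowen_C f E t e' \<le> bowen_C f E t e" for t
    unfolding bowen_C_eq_SUP bowen_C_n_def
    by (intro SUP_mono' INF_superset_mono bowen_covers_mono_radius assms) auto
  then have "{t. bowen_C f E t e = 0} \<subseteq> {t. bowen_C f E t e' = 0}"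
    by (intro Collect_mono impI) (metis le_zero_eq)
  then show ?thesis
    unfolding htop_on_eps_def by (intro Inf_superset_mono image_mono)
qed

lemma htop_on_eq_SUP: "htop_on f E = (SUP e\<in>{0<..}. htop_on_eps f E e)"
  unfolding htop_on_def by (intro Lim_at_right_antimono htop_on_eps_antimono)

text \<open>If a point of \<open>Z\<close> were far from all of \<open>Q\<close> it could be added to \<open>Q\<close>, so a separated set of maximal cardinality spans.\<close>
lemma maximal_separated_points:
  assumes "\<And>Q. finite Q \<Longrightarrow> Q \<subseteq> Z \<Longrightarrow> separated_points f n e Q \<Longrightarrow> real (card Q) \<le> B"
    and "0 \<le> e"
  obtains Q where "finite Q" "Q \<subseteq> Z" "separated_points f n e Q"
    "\<And>x. x \<in> Z \<Longrightarrow> \<exists>q\<in>Q. \<forall>i<n. dist ((f ^^ i) x) ((f ^^ i) q) \<le> e"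
proof -
  define F where "F = {Q. finite Q \<and> Q \<subseteq> Z \<and> separated_points f n e Q}"
  have "{} \<in> F" by (auto simp: F_def separated_points_def)
  moreover have "\<forall>Q. Q \<in> F \<longrightarrow> card Q < Suc (nat \<lfloor>B\<rfloor>)"
    using assms(1) by (auto simp: F_def less_Suc_eq_le le_nat_floor)
  ultimately obtain Q where Q: "Q \<in> F" and max: "\<And>Q'. Q' \<in> F \<Longrightarrow> card Q' \<le> card Q"
    using ex_has_greatest_nat[of "\<lambda>Q. Q \<in> F" "{}" card "Suc (nat \<lfloor>B\<rfloor>)"] by auto
  have "\<exists>q\<in>Q. \<forall>i<n. dist ((f ^^ i) x) ((f ^^ i) q) \<le> e" if x: "x \<in> Z" for x
  proof (rule ccontr)
    assume "\<not> ?thesis"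
    then have far: "\<forall>q\<in>Q. \<exists>i<n. e < dist ((f ^^ i) x) ((f ^^ i) q)" by (auto simp: not_le)
    then have "x \<notin> Q" using \<open>0 \<le> e\<close> by force
    have "insert x Q \<in> F"
      using Q x far by (auto simp: F_def separated_points_def dist_commute)
    then show False using max[of "insert x Q"] \<open>x \<notin> Q\<close> Q by (auto simp: F_def)
  qed
  then show thesis using Q that by (auto simp: F_def)
qed

lemma htop_nonneg:
  fixes f :: "'a::metric_space \<Rightarrow> 'a"
  shows "0 \<le> htop f"
proof -
  have "0 \<le> (SUP A\<in>{A. finite A \<and> A \<noteq> {} \<and> separated f n 1 A}. ereal (ln (real (card A)) / real n))" for n
    by (rule SUP_upper2[of "{undefined}"]) (auto simp: separated_def)
  then have "0 \<le> htop_eps f 1" unfolding htop_eps_def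
    by (intro order_trans[OF _ Liminf_le_Limsup] Liminf_bounded) auto
  also have "\<dots> \<le> htop f" unfolding htop_eq_SUP by (intro SUP_upper) auto
  finally show ?thesis .
qed

lemma eventually_card_separated_less:
  assumes "htop_eps f e < ereal t"
  shows "\<forall>\<^sub>F n in sequentially. 0 < n \<and> (\<forall>A. finite A \<longrightarrow> separated_points f n e A \<longrightarrow> real (card A) \<le> exp (t * real n))"
proof -
  have "\<forall>\<^sub>F n in sequentially. (SUP A\<in>{A. finite A \<and> A \<noteq> {} \<and> separated f n e A}. ereal (ln (real (card A)) / real n)) < ereal t"
    using assms unfolding htop_eps_def by (rule Limsup_lessD)
  then show ?thesis
    using eventually_gt_at_top[of 0]
  proof eventually_elim
    case (elim n)
    have "real (card A) \<le> exp (t * real n)" if A: "finite A" "separated_points f n e A" for A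
    proof (cases "A = {}")
      case False
      then have "ereal (ln (real (card A)) / real n) < ereal t"
        using A elim by (intro le_less_trans[OF SUP_upper elim(1)]) (auto simp: separated_iff_separated_points)
      then have "ln (real (card A)) < t * real n" using elim by (simp add: field_simps)
      then show ?thesis using False A
        by (metis card_gt_0_iff exp_le_cancel_iff exp_ln less_eq_real_def of_nat_0_less_iff)
    qed simp
    then show ?case using elim by auto
  qed
qed

text \<open>A maximal \<open>(n, e/2)\<close>-separated set of the whole space centres a cover by Bowen balls all of the
same length \<open>n\<close>. For \<open>t\<close> above the entropy its weight is at most \<open>exp (- (t - s) n)\<close> with
some \<open>s < t\<close>, which vanishes as \<open>n\<close> grows.\<close>
lemma htop_on_eps_le_htop:
  assumes e: "0 < e"
  shows "htop_on_eps f E e \<le> htop f"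
proof (rule dense_ge)
  fix z assume z: "htop f < z"
  show "htop_on_eps f E e \<le> z"
  proof (cases z)
    case (real t)
    obtain s where s: "htop f < ereal s" "s < t"
      using ereal_dense2[of "htop f" "ereal t"] z real by auto
    have "htop_eps f (e/2) \<le> htop f" unfolding htop_eq_SUP using e by (intro SUP_upper) auto
    also have "\<dots> < ereal s" by fact
    finally have ev: "\<forall>\<^sub>F n in sequentially. 0 < n \<and>
        (\<forall>A. finite A \<longrightarrow> separated_points f n (e/2) A \<longrightarrow> real (card A) \<le> exp (s * real n))"
      by (rule eventually_card_separated_less)
    have "\<forall>\<^sub>F n in sequentially. bowen_C_n f E t n e \<le> ennreal (exp (- (t - s) * real n))"
      using ev
    proof eventually_elim
      case (elim n)
      obtain Q where Q: "finite Q" "separated_points f n (e/2) Q"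
        and span: "\<And>x. \<exists>q\<in>Q. \<forall>i<n. dist ((f ^^ i) x) ((f ^^ i) q) \<le> e/2"
        using maximal_separated_points[of UNIV f n "e/2"] elim e by (metis UNIV_I less_eq_real_def half_gt_zero)
      have "x \<in> (\<Union>(u, q)\<in>{n} \<times> Q. bowen_ball f u q e)" for x
      proof -
        obtain q where "q \<in> Q" "\<forall>i<n. dist ((f ^^ i) x) ((f ^^ i) q) \<le> e/2" using span by blast
        moreover then have "\<forall>i<n. dist ((f ^^ i) q) ((f ^^ i) x) < e"
          using e by (metis dist_commute field_sum_of_halves le_less_trans less_add_same_cancel1 half_gt_zero)
        ultimately show ?thesis using elim by (auto simp: bowen_ball_def bowen_dist_less_iff)
      qed
      then have "{n} \<times> Q \<in> bowen_covers f E n e"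
        using Q by (auto simp: bowen_covers_def countable_finite)
      then have "bowen_C_n f E t n e \<le> (\<Sum>\<^sub>\<infinity>(u, x)\<in>{n} \<times> Q. ennreal (exp (- t * real u)))"
        unfolding bowen_C_n_def by (rule INF_lower)
      also have "\<dots> = (\<Sum>(u, x)\<in>{n} \<times> Q. ennreal (exp (- t * real u)))"
        using Q by (intro infsum_finite) auto
      also have "\<dots> = ennreal (real (card Q) * exp (- t * real n))"
        by (simp add: sum.cartesian_product[symmetric] ennreal_mult ennreal_of_nat_eq_real_of_nat)
      also have "\<dots> \<le> ennreal (exp (s * real n) * exp (- t * real n))"
        using elim Q by (intro ennreal_leI mult_right_mono) auto
      also have "\<dots> = ennreal (exp (- (t - s) * real n))"
        by (simp add: exp_add[symmetric] algebra_simps)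
      finally show ?case .
    qed
    moreover have "(\<lambda>n. ennreal (exp (- (t - s) * real n))) \<longlonglongrightarrow> ennreal 0"
    proof (intro tendsto_ennrealI)
      have "(\<lambda>n. exp (- (t - s)) ^ n) \<longlonglongrightarrow> 0"
        using s by (intro LIMSEQ_power_zero) auto
      then show "(\<lambda>n. exp (- (t - s) * real n)) \<longlonglongrightarrow> 0"
        by (simp add: exp_of_nat2_mult[symmetric])
    qed
    moreover have "(\<lambda>n. bowen_C_n f E t n e) \<longlonglongrightarrow> bowen_C f E t e"
      unfolding bowen_C_eq_SUP bowen_C_n_def
      by (intro LIMSEQ_SUP monoI INF_superset_mono bowen_covers_mono) auto
    ultimately have "bowen_C f E t e \<le> ennreal 0"
      by (intro tendsto_le[OF sequentially_bot])
    then show ?thesis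
      unfolding htop_on_eps_def real by (intro Inf_lower) auto
  qed (use z in auto)
qed

section \<open>Entropy is carried by loops at one cell\<close>

lemma finite_cells:
  fixes d :: real
  assumes "compact (UNIV :: 'a::metric_space set)" "0 < d"
  obtains \<kappa> :: "'a::metric_space \<Rightarrow> 'a" where "finite (range \<kappa>)" "\<And>x y. \<kappa> x = \<kappa> y \<Longrightarrow> dist x y < d"
proof -
  have "UNIV \<subseteq> (\<Union>x::'a\<in>UNIV. ball x (d/2))"
    using assms(2) by (intro subsetI UN_I[OF UNIV_I]) (rule centre_in_ball[THEN iffD2], simp)
  then obtain k :: "'a set" where k: "finite k" "UNIV \<subseteq> (\<Union>x\<in>k. ball x (d/2))"
    by (rule compactE_image[OF assms(1) open_ball])
  have "\<forall>x. \<exists>c\<in>k. dist c x < d/2" using k(2) by (auto simp: subset_iff)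
  then obtain \<kappa> where \<kappa>: "\<And>x. \<kappa> x \<in> k" "\<And>x. dist (\<kappa> x) x < d/2" by metis
  have "finite (range \<kappa>)" using \<kappa>(1) k(1) by (auto intro: finite_subset)
  moreover have "dist x y < d" if "\<kappa> x = \<kappa> y" for x y
    using \<kappa>(2)[of x] \<kappa>(2)[of y] that dist_triangle_half_r[of "\<kappa> x" x d y] by simp
  ultimately show thesis using that by blast
qed

lemma card_le_fibres:
  assumes "finite A" "finite T" "g ` A \<subseteq> T" "\<And>t. t \<in> T \<Longrightarrow> real (card {x\<in>A. g x = t}) \<le> B"
  shows "real (card A) \<le> real (card T) * B"
proof -
  have "card A = (\<Sum>t\<in>T. card {x\<in>A. g x = t})"
    using sum.group[OF assms(1-3), of "\<lambda>_. 1::nat"] by simp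
  then have "real (card A) = (\<Sum>t\<in>T. real (card {x\<in>A. g x = t}))" by simp
  also have "\<dots> \<le> (\<Sum>t\<in>T. B)" using assms(4) by (intro sum_mono)
  finally show ?thesis by simp
qed

text \<open>The step in the induction cuts every orbit at the last visit \<open>\<tau> x\<close> to the cell in which it starts.
The part before is a loop, of which there are few up to \<open>e/2\<close>; the part after avoids that
cell for good, so the induction hypothesis for one cell less applies to it. Each cut costs a factor
\<open>C * K * (n + 1)\<close>, with \<open>C\<close> from the bound for loops, \<open>K\<close> for the cell and \<open>n + 1\<close> for the time,
whereas the exponential factors of the two parts multiply to at most \<open>exp (h n)\<close>.\<close>
lemma card_le_of_loop_bound:
  fixes f :: "'a::metric_space \<Rightarrow> 'a" and \<kappa> :: "'a \<Rightarrow> 'b"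
  assumes cells: "\<And>x y. \<kappa> x = \<kappa> y \<Longrightarrow> dist x y < e"
    and e: "0 < e" and C: "1 \<le> C" and h: "0 \<le> h" and K: "1 \<le> K"
    and loops: "\<And>l c Q. finite Q \<Longrightarrow> Q \<subseteq> {x. \<kappa> x = c \<and> \<kappa> ((f ^^ l) x) = c} \<Longrightarrow>
                 separated_points f l (e/2) Q \<Longrightarrow> real (card Q) \<le> C * exp (h * real l)"
  shows "finite S \<Longrightarrow> real (card S) \<le> K \<Longrightarrow> finite A \<Longrightarrow> separated_points f n e A \<Longrightarrow>
           (\<forall>x\<in>A. \<forall>i<n. \<kappa> ((f ^^ i) x) \<in> S) \<Longrightarrow>
           real (card A) \<le> (C * K * real (n + 1)) ^ card S * exp (h * real n)"
proof (induction S arbitrary: n A rule: finite_psubset_induct)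
  case (psubset S)
  define M where "M = C * K * real (n + 1)"
  have CK: "1 \<le> C * K" using mult_mono[OF C K] C K by auto
  then have M: "1 \<le> M" unfolding M_def using mult_mono[OF CK, of 1 "real (n + 1)"] by auto
  consider "n = 0 \<or> A = {}" | "0 < n" "A \<noteq> {}" by auto
  then show ?case
  proof cases
    case 1
    then have "\<forall>x\<in>A. \<forall>y\<in>A. x = y"
      using psubset.prems(3) by (auto simp: separated_points_def)
    then have "real (card A) \<le> 1"
      using card_le_Suc0_iff_eq[OF psubset.prems(2)] by auto
    also have "\<dots> \<le> M ^ card S * exp (h * real n)"
      using mult_mono[OF one_le_power[OF M, of "card S"], of 1 "exp (h * real n)"] h M by auto
    finally show ?thesis by (simp add: M_def)
  next
    case 2
    define \<tau> where "\<tau> x = Max {i. i < n \<and> \<kappa> ((f ^^ i) x) = \<kappa> x}" for x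
    have \<tau>: "\<tau> x < n \<and> \<kappa> ((f ^^ \<tau> x) x) = \<kappa> x" for x
    proof -
      have "\<tau> x \<in> {i. i < n \<and> \<kappa> ((f ^^ i) x) = \<kappa> x}"
        unfolding \<tau>_def using \<open>0 < n\<close> by (intro Max_in) (auto intro!: exI[of _ 0])
      then show ?thesis by simp
    qed
    have last: "i \<le> \<tau> x" if "i < n" "\<kappa> ((f ^^ i) x) = \<kappa> x" for x i
      unfolding \<tau>_def using that by (intro Max_ge) auto
    \<comment> \<open>As separated sets of loops are bounded in size, finitely many representatives come within
      \<open>e/2\<close> of all loops.\<close>
    define spanning where "spanning l c Q \<longleftrightarrow>
        finite Q \<and> Q \<subseteq> {x. \<kappa> x = c \<and> \<kappa> ((f ^^ l) x) = c} \<and> separated_points f l (e/2) Q \<and>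
        (\<forall>x. \<kappa> x = c \<and> \<kappa> ((f ^^ l) x) = c \<longrightarrow> (\<exists>q\<in>Q. \<forall>i<l. dist ((f ^^ i) x) ((f ^^ i) q) \<le> e/2))"
      for l c Q
    have "\<exists>Q. spanning l c Q" for l c
    proof -
      let ?Z = "{x. \<kappa> x = c \<and> \<kappa> ((f ^^ l) x) = c}"
      obtain Q where "finite Q" "Q \<subseteq> ?Z" "separated_points f l (e/2) Q"
          "\<And>x. x \<in> ?Z \<Longrightarrow> \<exists>q\<in>Q. \<forall>i<l. dist ((f ^^ i) x) ((f ^^ i) q) \<le> e/2"
      proof (rule maximal_separated_points)
        show "real (card Q) \<le> C * exp (h * real l)"
          if "finite Q" "Q \<subseteq> ?Z" "separated_points f l (e/2) Q" for Q
          using loops that .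
        show "0 \<le> e/2" using e by simp
      qed blast
      then show ?thesis unfolding spanning_def by blast
    qed
    then obtain Q where "\<And>l c. spanning l c (Q l c)" by metis
    then have Q: "finite (Q l c)" "Q l c \<subseteq> {x. \<kappa> x = c \<and> \<kappa> ((f ^^ l) x) = c}"
        "separated_points f l (e/2) (Q l c)"
      and span: "\<kappa> x = c \<Longrightarrow> \<kappa> ((f ^^ l) x) = c \<Longrightarrow>
                   \<exists>q\<in>Q l c. \<forall>i<l. dist ((f ^^ i) x) ((f ^^ i) q) \<le> e/2" for l c x
      unfolding spanning_def by blast+
    have "\<forall>x. \<exists>q\<in>Q (\<tau> x) (\<kappa> x). \<forall>i<\<tau> x. dist ((f ^^ i) x) ((f ^^ i) q) \<le> e/2"
      using span \<tau> by blast
    then obtain q where q: "\<And>x. q x \<in> Q (\<tau> x) (\<kappa> x)"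
        "\<And>x i. i < \<tau> x \<Longrightarrow> dist ((f ^^ i) x) ((f ^^ i) (q x)) \<le> e/2" by metis
    define s where "s = card S - 1"
    have "S \<noteq> {}" using psubset.prems(4) 2 by force
    then have s: "card S = Suc s" using psubset.hyps by (simp add: s_def card_gt_0_iff)
    have fibre: "real (card {x\<in>A. (\<kappa> x, \<tau> x) = t}) \<le> C * M ^ s * exp (h * real n)"
      if t: "t \<in> S \<times> {..<n}" for t
    proof -
      obtain c l where cl: "t = (c, l)" "c \<in> S" "l < n" using t by auto
      define F where "F = {x\<in>A. (\<kappa> x, \<tau> x) = t}"
      have F: "x \<in> A" "\<kappa> x = c" "\<tau> x = l" if "x \<in> F" for x using that by (auto simp: F_def cl)
      define N where "N = n - l - 1"
      have sub: "real (card {x\<in>F. q x = p}) \<le> M ^ s * exp (h * real N)" for p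
      proof -
        define G where "G = {x\<in>F. q x = p}"
        \<comment> \<open>Points with the same representative agree up to \<open>e\<close> before time \<open>l\<close>, and at time \<open>l\<close>
          they share a cell, so they are separated only afterwards.\<close>
        have far: "\<exists>i<N. e < dist ((f ^^ i) ((f ^^ Suc l) x)) ((f ^^ i) ((f ^^ Suc l) y))"
          if xy: "x \<in> G" "y \<in> G" "x \<noteq> y" for x y
        proof -
          have xF: "x \<in> F" "y \<in> F" "q x = p" "q y = p" using xy by (auto simp: G_def)
          obtain i where i: "i < n" "e < dist ((f ^^ i) x) ((f ^^ i) y)"
            using psubset.prems(3) F(1)[OF xF(1)] F(1)[OF xF(2)] xy(3)
            unfolding separated_points_def by blast
          have "\<not> i < l"
          proof
            assume "i < l"
            then have "dist ((f ^^ i) x) ((f ^^ i) p) \<le> e/2" "dist ((f ^^ i) y) ((f ^^ i) p) \<le> e/2"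
              using q(2)[of i x] q(2)[of i y] xF F by auto
            then show False using i(2) dist_triangle2[of "(f ^^ i) x" "(f ^^ i) y" "(f ^^ i) p"] by linarith
          qed
          moreover have "i \<noteq> l"
          proof
            assume "i = l"
            then have "\<kappa> ((f ^^ i) x) = \<kappa> ((f ^^ i) y)" using \<tau>[of x] \<tau>[of y] xF F by metis
            then show False using cells i(2) by (meson less_asym)
          qed
          ultimately obtain k where k: "i = k + Suc l"
            by (metis add.commute less_imp_add_positive linorder_neqE_nat add_Suc_shift gr0_implies_Suc)
          have "(f ^^ i) w = (f ^^ k) ((f ^^ Suc l) w)" for w
            by (simp only: k funpow_add o_apply)
          then show ?thesis using i k by (intro exI[of _ k]) (auto simp: N_def)
        qed
        have inj: "inj_on (f ^^ Suc l) G"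
          using far e by (intro inj_onI) (metis dist_self less_asym)
        have "real (card ((f ^^ Suc l) ` G)) \<le> (C * K * real (N + 1)) ^ card (S - {c}) * exp (h * real N)"
        proof (rule psubset.IH)
          show "S - {c} \<subset> S" using cl by auto
          show "real (card (S - {c})) \<le> K"
            using psubset.prems(1) card_mono[OF psubset.hyps, of "S - {c}"] by auto
          show "finite ((f ^^ Suc l) ` G)" using psubset.prems(2) by (simp add: G_def F_def)
          show "separated_points f N e ((f ^^ Suc l) ` G)"
            using far unfolding separated_points_def by fast
          show "\<forall>x\<in>(f ^^ Suc l) ` G. \<forall>i<N. \<kappa> ((f ^^ i) x) \<in> S - {c}"
          proof (intro ballI allI impI)
            fix x' i assume "x' \<in> (f ^^ Suc l) ` G" and i: "i < N"
            then obtain x where x: "x \<in> F" "x' = (f ^^ Suc l) x" by (auto simp: G_def)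
            have eq: "(f ^^ i) x' = (f ^^ (i + Suc l)) x" by (simp only: x(2) funpow_add o_apply)
            have "i + Suc l < n" using i by (simp add: N_def)
            then have "\<kappa> ((f ^^ (i + Suc l)) x) \<in> S" "\<kappa> ((f ^^ (i + Suc l)) x) \<noteq> c"
              using psubset.prems(4) F[OF x(1)] last[of "i + Suc l" x] by (blast, force)
            then show "\<kappa> ((f ^^ i) x') \<in> S - {c}" by (simp only: eq) simp
          qed
        qed
        also have "card (S - {c}) = s" using cl psubset.hyps s by simp
        also have "(C * K * real (N + 1)) ^ s \<le> M ^ s"
          using CK unfolding M_def N_def by (intro power_mono mult_left_mono) auto
        also have "card ((f ^^ Suc l) ` G) = card G" by (rule card_image[OF inj])
        finally show ?thesis by (simp add: G_def)
      qed
      have "real (card F) \<le> real (card (Q l c)) * (M ^ s * exp (h * real N))"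
      proof (rule card_le_fibres[where g = q])
        show "finite F" using psubset.prems(2) by (simp add: F_def)
        show "finite (Q l c)" by (rule Q(1))
        show "q ` F \<subseteq> Q l c"
        proof
          fix p assume "p \<in> q ` F"
          then obtain x where "x \<in> F" "p = q x" by blast
          then show "p \<in> Q l c" using q(1)[of x] F(2,3)[of x] by simp
        qed
      qed (rule sub)
      also have "\<dots> \<le> (C * exp (h * real l)) * (M ^ s * exp (h * real N))"
        using loops[OF Q(1) Q(2) Q(3)] M by (intro mult_right_mono) auto
      also have "\<dots> = C * M ^ s * exp (h * (real l + real N))" by (simp add: exp_add distrib_left)
      also have "\<dots> \<le> C * M ^ s * exp (h * real n)"
        using C M h cl(3) by (intro mult_left_mono) (auto simp: N_def intro!: mult_left_mono)
      finally show ?thesis by (simp add: F_def)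
    qed
    have "real (card A) \<le> real (card (S \<times> {..<n})) * (C * M ^ s * exp (h * real n))"
    proof (rule card_le_fibres[where g = "\<lambda>x. (\<kappa> x, \<tau> x)"])
      show "(\<lambda>x. (\<kappa> x, \<tau> x)) ` A \<subseteq> S \<times> {..<n}"
      proof
        fix t assume "t \<in> (\<lambda>x. (\<kappa> x, \<tau> x)) ` A"
        then obtain x where x: "x \<in> A" "t = (\<kappa> x, \<tau> x)" by blast
        have "\<kappa> ((f ^^ 0) x) \<in> S" using psubset.prems(4) x(1) \<open>0 < n\<close> by blast
        then show "t \<in> S \<times> {..<n}" using x(2) \<tau>[of x] by simp
      qed
    qed (use psubset.prems(2) psubset.hyps fibre in auto)
    also have "\<dots> = (real (card S) * real n * C) * (M ^ s * exp (h * real n))"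
      by (simp add: card_cartesian_product)
    also have "\<dots> \<le> M * (M ^ s * exp (h * real n))"
    proof (intro mult_right_mono)
      have "real (card S) * real n * C \<le> K * real (n + 1) * C"
        using psubset.prems(1) C K by (intro mult_mono) auto
      then show "real (card S) * real n * C \<le> M" by (simp add: M_def mult_ac)
    qed (use M in auto)
    finally have "real (card A) \<le> M ^ card S * exp (h * real n)" by (simp only: s power_Suc mult.assoc)
    then show ?thesis by (simp only: M_def)
  qed
qed

text \<open>Otherwise the bound of \<open>card_le_of_loop_bound\<close>, a polynomial in \<open>n\<close> times \<open>exp (h n)\<close>, would
hold for all separated sets. The factor \<open>C\<close> can be prescribed, because a constant
has no influence on growth rates; a large one forces the loops to be numerous compared with their length.\<close>
lemma loops_of_positive_entropy:
  fixes f :: "'a::metric_space \<Rightarrow> 'a" and \<kappa> :: "'a \<Rightarrow> 'b"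
  assumes cells: "\<And>x y. \<kappa> x = \<kappa> y \<Longrightarrow> dist x y < e" "finite (range \<kappa>)"
    and e: "0 < e" and C: "1 \<le> C" and h: "0 \<le> h" "ereal h < htop_eps f e"
  obtains l c P where "finite P" "P \<subseteq> {x. \<kappa> x = c \<and> \<kappa> ((f ^^ l) x) = c}"
    "separated_points f l (e/2) P" "C * exp (h * real l) < real (card P)"
proof (rule ccontr)
  assume none: "\<not> thesis"
  note found = that
  have loops: "real (card Q) \<le> C * exp (h * real l)"
    if "finite Q" "Q \<subseteq> {x. \<kappa> x = c \<and> \<kappa> ((f ^^ l) x) = c}" "separated_points f l (e/2) Q" for l c Q
    using found[OF that] none by (meson not_le)
  define k where "k = card (range \<kappa>)"
  have "range \<kappa> \<noteq> {}" by auto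
  then have k: "1 \<le> real k" using cells(2) unfolding k_def by (simp add: Suc_leI card_gt_0_iff)
  have Ck: "0 < C * real k" using C k by auto
  define u where "u n = h + real k * (ln (2 * C * real k) / real n + ln (real n) / real n)" for n
  have "u \<longlonglongrightarrow> h + real k * (0 + 0)"
    unfolding u_def by (intro tendsto_intros lim_const_over_n lim_ln_over_n)
  then have "u \<longlonglongrightarrow> h" by simp
  have "htop_eps f e \<le> limsup (\<lambda>n. ereal (u n))"
    unfolding htop_eps_def
  proof (intro Limsup_mono eventually_mono[OF eventually_gt_at_top[of 0]] SUP_least)
    fix n A assume n: "0 < n" and "A \<in> {A. finite A \<and> A \<noteq> {} \<and> separated f n e A}"
    then have A: "finite A" "A \<noteq> {}" "separated_points f n e A"
      by (auto simp: separated_iff_separated_points)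
    have "real (card A) \<le> (C * real k * real (n + 1)) ^ k * exp (h * real n)"
      unfolding k_def
    proof (rule card_le_of_loop_bound)
      show "dist x y < e" if "\<kappa> x = \<kappa> y" for x y by (rule cells(1)[OF that])
      show "real (card Q) \<le> C * exp (h * real l)"
        if "finite Q" "Q \<subseteq> {x. \<kappa> x = c \<and> \<kappa> ((f ^^ l) x) = c}" "separated_points f l (e/2) Q" for l c Q
        by (rule loops[OF that])
    qed (use e C h k A cells(2) in \<open>auto simp: k_def\<close>)
    also have "\<dots> \<le> (2 * C * real k * real n) ^ k * exp (h * real n)"
    proof -
      have "C * real k * real (n + 1) \<le> C * real k * (2 * real n)"
        using n Ck by (intro mult_left_mono) auto
      moreover have "0 \<le> C * real k * real (n + 1)" using C k by (intro mult_nonneg_nonneg) auto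
      ultimately show ?thesis by (intro mult_right_mono power_mono) (auto simp: mult_ac)
    qed
    finally have "ln (real (card A)) \<le> ln ((2 * C * real k * real n) ^ k * exp (h * real n))"
      using A by (intro ln_mono) (auto simp: card_gt_0_iff)
    also have "\<dots> = real k * (ln (2 * C * real k) + ln (real n)) + h * real n"
      using n Ck C k by (simp add: ln_mult ln_realpow)
    finally show "ereal (ln (real (card A)) / real n) \<le> ereal (u n)"
      using n by (simp add: u_def field_simps)
  qed
  also have "\<dots> = ereal h"
    by (intro lim_imp_Limsup) (simp_all add: \<open>u \<longlonglongrightarrow> h\<close>)
  finally show False using h(2) by simp
qed

section \<open>Loops and their concatenation\<close>

text \<open>A pseudo-orbit segment of length \<open>l\<close> that any point of its initial cell \<open>c\<close> continues, if cells
have diameter below \<open>d\<close>: the cell is required of the image of the last point, not of the last point itself.\<close>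
definition chain_loop :: "('a::metric_space \<Rightarrow> 'a) \<Rightarrow> real \<Rightarrow> ('a \<Rightarrow> 'b) \<Rightarrow> 'b \<Rightarrow> nat \<Rightarrow> (nat \<Rightarrow> 'a) \<Rightarrow> bool" where
  "chain_loop f d \<kappa> c l p \<longleftrightarrow> 0 < l \<and> (\<forall>j. Suc j < l \<longrightarrow> dist (f (p j)) (p (Suc j)) < d) \<and>
     \<kappa> (p 0) = c \<and> \<kappa> (f (p (l - 1))) = c"

lemma pseudo_orbit_concat:
  assumes loop: "\<And>i. chain_loop f d \<kappa> c l (w i)" and cells: "\<And>x y. \<kappa> x = \<kappa> y \<Longrightarrow> dist x y < d"
  shows "pseudo_orbit f d (\<lambda>n. w (n div l) (n mod l))"
  unfolding pseudo_orbit_def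
proof
  fix n
  have l: "0 < l" using loop by (auto simp: chain_loop_def)
  show "dist (f (w (n div l) (n mod l))) (w (Suc n div l) (Suc n mod l)) < d"
  proof (cases "Suc (n mod l) = l")
    case True
    then have "Suc n mod l = 0" "n mod l = l - 1" by (auto simp: mod_Suc)
    then show ?thesis using loop cells by (auto simp: chain_loop_def)
  next
    case False
    then have "Suc (n mod l) < l" using mod_less_divisor[OF l, of n] by linarith
    moreover have "Suc n mod l = Suc (n mod l)" "Suc n div l = n div l"
      using False by (auto simp: mod_Suc div_Suc)
    ultimately show ?thesis using loop[of "n div l"] by (simp add: chain_loop_def)
  qed
qed

lemma chain_loop_repeat:
  assumes loop: "chain_loop f d \<kappa> c l p" and cells: "\<And>x y. \<kappa> x = \<kappa> y \<Longrightarrow> dist x y < d" and k: "0 < k"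
  shows "chain_loop f d \<kappa> c (k * l) (\<lambda>j. p (j mod l))"
proof -
  have l: "0 < l" using loop by (auto simp: chain_loop_def)
  obtain k' where k': "k = Suc k'" using k gr0_implies_Suc by blast
  have "k * l - 1 = (l - 1) + k' * l" using l by (simp add: k')
  then have "(k * l - 1) mod l = l - 1" using l by (simp only: mod_mult_self1) simp
  then show ?thesis
    using pseudo_orbit_concat[of f d \<kappa> c l "\<lambda>_. p"] loop cells k
    by (auto simp: chain_loop_def pseudo_orbit_def)
qed

section \<open>Irregular points force positive entropy\<close>

text \<open>Words of length \<open>L\<close> in two symbols are encoded as subsets of \<open>{..<L}\<close>. Two points that
follow different words are more than \<open>r\<close> apart at time \<open>j\<close> of a block in which the words differ, which
makes \<open>2 ^ L\<close> separated points for orbit length \<open>l * L\<close>.\<close>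
lemma htop_pos_of_two_words:
  fixes f :: "'a::metric_space \<Rightarrow> 'a"
  assumes trace: "\<And>w::nat \<Rightarrow> bool. \<exists>y. \<forall>n. dist ((f ^^ n) y) (p (w (n div l)) (n mod l)) < r"
    and j: "j < l" and r: "0 < r" "4 * r \<le> dist (p True j) (p False j)"
  shows "0 < htop f"
proof (rule ccontr)
  assume "\<not> 0 < htop f"
  have l: "0 < l" using j by auto
  have "htop_eps f r \<le> htop f" unfolding htop_eq_SUP using r by (intro SUP_upper) auto
  also have "\<dots> \<le> 0" using \<open>\<not> 0 < htop f\<close> by simp
  also have "0 < ereal (ln 2 / (2 * real l))" using l by simp
  finally have "\<forall>\<^sub>F n in sequentially. 0 < n \<and> (\<forall>A. finite A \<longrightarrow> separated_points f n r A \<longrightarrow>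
      real (card A) \<le> exp (ln 2 / (2 * real l) * real n))"
    by (rule eventually_card_separated_less)
  then obtain N where N: "\<And>n A. N \<le> n \<Longrightarrow> finite A \<Longrightarrow> separated_points f n r A \<Longrightarrow>
      real (card A) \<le> exp (ln 2 / (2 * real l) * real n)"
    by (auto simp: eventually_sequentially)
  define L where "L = Suc N"
  obtain y where y: "\<And>w n. dist ((f ^^ n) (y w)) (p (w (n div l)) (n mod l)) < r"
    using trace by metis
  define z where "z S = y (\<lambda>i. i \<in> S)" for S
  have sep: "\<exists>n<l * L. r < dist ((f ^^ n) (z S)) ((f ^^ n) (z S'))"
    if S: "S \<subseteq> {..<L}" "S' \<subseteq> {..<L}" "S \<noteq> S'" for S S'
  proof -
    obtain i where i: "i < L" "(i \<in> S) \<noteq> (i \<in> S')" using S by blast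
    define n where "n = i * l + j"
    have n: "n div l = i" "n mod l = j" using j by (auto simp: n_def)
    have "n < Suc i * l" using j by (simp add: n_def)
    also have "\<dots> \<le> l * L" using i by (metis Suc_leI mult.commute mult_le_mono1)
    finally have "n < l * L" .
    moreover have "4 * r \<le> dist (p (i \<in> S) j) (p (i \<in> S') j)"
      using i(2) r(2) by (cases "i \<in> S") (auto simp: dist_commute)
    then have "r < dist ((f ^^ n) (z S)) ((f ^^ n) (z S'))"
      using y[of n "\<lambda>i. i \<in> S"] y[of n "\<lambda>i. i \<in> S'"] r(1)
        dist_triangle[of "p (i \<in> S) j" "p (i \<in> S') j" "(f ^^ n) (z S)"]
        dist_triangle[of "(f ^^ n) (z S)" "p (i \<in> S') j" "(f ^^ n) (z S')"]
      unfolding n z_def by (simp add: dist_commute)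
    ultimately show ?thesis by blast
  qed
  have inj: "inj_on z (Pow {..<L})"
    using sep r(1) by (intro inj_onI) (metis PowD dist_self less_asym)
  have "separated_points f (l * L) r (z ` Pow {..<L})"
    unfolding separated_points_def
  proof (intro ballI impI)
    fix x y assume "x \<in> z ` Pow {..<L}" "y \<in> z ` Pow {..<L}" "x \<noteq> y"
    then obtain S S' where "S \<subseteq> {..<L}" "S' \<subseteq> {..<L}" "x = z S" "y = z S'" by auto
    then show "\<exists>i<l * L. r < dist ((f ^^ i) x) ((f ^^ i) y)"
      using sep[of S S'] \<open>x \<noteq> y\<close> by auto
  qed
  moreover have "N \<le> l * L" using l by (cases l) (auto simp: L_def)
  ultimately have "real (card (z ` Pow {..<L})) \<le> exp (ln 2 / (2 * real l) * real (l * L))"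
    by (intro N) auto
  then have "2 ^ L \<le> exp (real L * (ln 2 / 2))"
    using l by (simp add: card_image[OF inj] card_Pow field_simps)
  also have "\<dots> < exp (real L * ln 2)" by (simp add: L_def)
  also have "\<dots> = 2 ^ L" by (simp add: exp_of_nat_mult)
  finally show False by simp
qed

text \<open>A bounded sequence clusters at some \<open>c\<close>; as it does not converge to \<open>c\<close>, it also stays away
from \<open>c\<close> infinitely often, and on one side infinitely often.\<close>
lemma oscillation:
  fixes A :: "nat \<Rightarrow> real"
  assumes bd: "\<And>n. \<bar>A n\<bar> \<le> M" and nc: "\<not> convergent A"
  obtains a b where "a < b" "infinite {n. A n < a}" "infinite {n. b < A n}"
proof -
  have "seq_compact {-M..M}" by (intro compact_imp_seq_compact) auto
  moreover have "\<forall>n. A n \<in> {-M..M}" using bd by (auto simp: abs_le_iff minus_le_iff)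
  ultimately obtain c r where r: "strict_mono r" "(A \<circ> r) \<longlonglongrightarrow> c" by (auto elim!: seq_compactE)
  have near: "infinite {n. \<bar>A n - c\<bar> < d}" if d: "0 < d" for d
    unfolding infinite_nat_iff_unbounded_le
  proof
    fix m
    obtain N where N: "\<And>n. N \<le> n \<Longrightarrow> \<bar>A (r n) - c\<bar> < d"
      using LIMSEQ_D[OF r(2) d] by auto
    have "m \<le> r (max m N)" using seq_suble[OF r(1), of "max m N"] by simp
    moreover have "r (max m N) \<in> {n. \<bar>A n - c\<bar> < d}" using N by simp
    ultimately show "\<exists>n\<ge>m. n \<in> {n. \<bar>A n - c\<bar> < d}" by blast
  qed
  have "\<not> A \<longlonglongrightarrow> c" using nc by (auto simp: convergent_def)
  then obtain e where e: "0 < e" "\<forall>N. \<exists>n\<ge>N. e \<le> \<bar>A n - c\<bar>"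
    by (auto simp: LIMSEQ_iff not_less)
  then have "infinite {n. e \<le> \<bar>A n - c\<bar>}" by (auto simp: infinite_nat_iff_unbounded_le)
  moreover have "{n. e \<le> \<bar>A n - c\<bar>} = {n. c + e \<le> A n} \<union> {n. A n \<le> c - e}" by auto
  ultimately have "infinite {n. c + e \<le> A n} \<or> infinite {n. A n \<le> c - e}" by simp
  then show thesis
  proof
    assume *: "infinite {n. c + e \<le> A n}"
    show thesis
    proof (rule that)
      show "c + e/3 < c + e/2" using e by simp
      show "infinite {n. A n < c + e/3}" using e(1) by (intro infinite_super[OF _ near[of "e/3"]]) (auto split: abs_split)
      show "infinite {n. c + e/2 < A n}" using e by (intro infinite_super[OF _ *]) auto
    qed
  next
    assume *: "infinite {n. A n \<le> c - e}"
    show thesis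
    proof (rule that)
      show "c - e/2 < c - e/3" using e by simp
      show "infinite {n. c - e/3 < A n}" using e(1) by (intro infinite_super[OF _ near[of "e/3"]]) (auto split: abs_split)
      show "infinite {n. A n < c - e/2}" using e by (intro infinite_super[OF _ *]) auto
    qed
  qed
qed

lemma infinite_real_gt:
  assumes "infinite (N :: nat set)" obtains n where "n \<in> N" "x < real n" "k < n"
proof -
  obtain n where "n \<in> N" "max (nat \<lceil>x\<rceil> + 1) (Suc k) \<le> n"
    using assms by (auto simp: infinite_nat_iff_unbounded_le)
  then show thesis using that[of n] by linarith
qed

lemma infinite_in_one_cell:
  assumes "infinite N" "finite (range \<kappa>)"
  obtains c where "infinite {n\<in>N. \<kappa> (g n) = c}"
proof -
  have "finite ((\<kappa> \<circ> g) ` N)" using assms(2) by (rule finite_subset[rotated]) auto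
  then obtain n0 where "infinite {n\<in>N. (\<kappa> \<circ> g) n = (\<kappa> \<circ> g) n0}"
    using pigeonhole_infinite[OF assms(1)] by blast
  then show thesis using that by auto
qed

lemma sum_lessThan_add:
  fixes g :: "nat \<Rightarrow> real"
  shows "(\<Sum>j<m + k. g j) = (\<Sum>j<m. g j) + (\<Sum>j<k. g (m + j))"
  by (induction k) simp_all

lemma sum_repeat:
  fixes g :: "nat \<Rightarrow> real"
  shows "(\<Sum>j<k * l. g (j mod l)) = real k * (\<Sum>j<l. g j)"
proof (induction k)
  case (Suc k)
  have "(\<Sum>j<Suc k * l. g (j mod l)) = (\<Sum>j<k * l + l. g (j mod l))" by (simp add: add.commute)
  also have "\<dots> = (\<Sum>j<k * l. g (j mod l)) + (\<Sum>j<l. g ((k * l + j) mod l))" by (rule sum_lessThan_add)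
  also have "(\<Sum>j<l. g ((k * l + j) mod l)) = (\<Sum>j<l. g j)" by (intro sum.cong) auto
  finally show ?case by (simp add: Suc.IH algebra_simps)
qed simp

text \<open>The orbit of \<open>z\<close> is in one cell \<open>u\<close> at infinitely many of the times of low average and in one
cell \<open>v\<close> at infinitely many of the times of high average. A piece from a fixed time in \<open>u\<close> to a very late time
of low average in \<open>u\<close> is a loop of low average. A piece up to a very late time of high average ends in
\<open>v\<close>, and the next return to \<open>u\<close> might take long enough to spoil the average. Instead it is closed by jumping back
to a fixed time \<open>c\<close> in \<open>v\<close> and following the orbit from there to a fixed visit \<open>e\<close> to \<open>u\<close>.
Repeating each loop as often as the other is long makes the lengths equal.\<close>
lemma oscillating_loops:
  fixes f :: "'a::metric_space \<Rightarrow> 'a" and \<phi> :: "'a \<Rightarrow> real" and z :: 'a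
  defines "S \<equiv> \<lambda>n. \<Sum>i<n. \<phi> ((f ^^ i) z)"
  assumes cells: "\<And>x y. \<kappa> x = \<kappa> y \<Longrightarrow> dist x y < d" "finite (range \<kappa>)" "0 < d"
    and inf: "infinite {n. S n / real n < \<alpha>}" "infinite {n. \<beta> < S n / real n}"
    and lt: "\<alpha> < \<alpha>'" "\<beta>' < \<beta>"
  obtains l c p q where "chain_loop f d \<kappa> c l p" "chain_loop f d \<kappa> c l q"
    "(\<Sum>j<l. \<phi> (p j)) \<le> real l * \<alpha>'" "real l * \<beta>' \<le> (\<Sum>j<l. \<phi> (q j))"
proof -
  define x where "x n = (f ^^ n) z" for n
  have fx: "f (x n) = x (Suc n)" for n by (simp add: x_def)
  have S: "S n = (\<Sum>i<n. \<phi> (x i))" for n by (simp add: S_def x_def)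
  have S_shift: "(\<Sum>j<k. \<phi> (x (m + j))) = S (m + k) - S m" for m k
    by (induction k) (simp_all add: S)
  obtain u where u: "infinite {n\<in>{n. S n / real n < \<alpha>}. \<kappa> (x n) = u}"
    using infinite_in_one_cell[OF inf(1) cells(2)] .
  obtain v where v: "infinite {n\<in>{n. \<beta> < S n / real n}. \<kappa> (x n) = v}"
    using infinite_in_one_cell[OF inf(2) cells(2)] .
  obtain s where s: "\<kappa> (x s) = u" using infinite_imp_nonempty[OF u] by auto
  obtain c where c: "\<kappa> (x c) = v" using infinite_imp_nonempty[OF v] by auto
  obtain e where e: "\<kappa> (x e) = u" "c < e" using infinite_real_gt[OF u] by (metis (mono_tags, lifting) mem_Collect_eq)
  \<comment> \<open>The bounds on \<open>n\<close> and \<open>n'\<close> make the contribution of the fixed pieces negligible.\<close>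
  obtain n where n: "S n / real n < \<alpha>" "\<kappa> (x n) = u" "(\<bar>real s * \<alpha>'\<bar> + \<bar>S s\<bar>) / (\<alpha>' - \<alpha>) < real n" "s < n"
    using infinite_real_gt[OF u, of "(\<bar>real s * \<alpha>'\<bar> + \<bar>S s\<bar>) / (\<alpha>' - \<alpha>)" s] by auto
  define K where "K = \<bar>(real e - real c - real s) * \<beta>'\<bar> + \<bar>S s - S e + S c\<bar>"
  obtain n' where n': "\<beta> < S n' / real n'" "\<kappa> (x n') = v" "K / (\<beta> - \<beta>') < real n'" "s < n'"
    using infinite_real_gt[OF v, of "K / (\<beta> - \<beta>')" s] by auto
  define lp where "lp = n - s"
  define p where "p j = x (s + j)" for j
  define lq where "lq = (n' - s) + (e - c)"
  define q where "q j = (if j < n' - s then x (s + j) else x (c + (j - (n' - s))))" for j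
  have lpos: "0 < lp" "0 < lq" using n n' by (auto simp: lp_def lq_def)
  have loop_p: "chain_loop f d \<kappa> u lp p"
    using n s cells(3) lpos by (auto simp: chain_loop_def p_def lp_def fx)
  have loop_q: "chain_loop f d \<kappa> u lq q"
    unfolding chain_loop_def
  proof (intro conjI allI impI)
    fix j assume j: "Suc j < lq"
    consider "Suc j < n' - s" | "Suc j = n' - s" | "n' - s \<le> j" by linarith
    then show "dist (f (q j)) (q (Suc j)) < d"
    proof cases
      case 1 then show ?thesis using cells(3) by (simp add: q_def fx)
    next
      case 2
      then have "j < n' - s" "Suc (s + j) = n'" by auto
      then have "f (q j) = x n'" "q (Suc j) = x c" using 2 by (simp_all add: q_def fx)
      then show ?thesis using n'(2) c by (auto intro!: cells(1))
    next
      case 3 then show ?thesis using cells(3) by (simp add: q_def fx Suc_diff_le)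
    qed
  next
    have "\<not> lq - 1 < n' - s" "Suc (c + (lq - 1 - (n' - s))) = e" using e by (auto simp: lq_def)
    then have "f (q (lq - 1)) = x e" by (simp add: q_def fx)
    then show "\<kappa> (f (q (lq - 1))) = u" using e by simp
  qed (use s n' lpos in \<open>auto simp: q_def\<close>)
  have "real n * (\<alpha>' - \<alpha>) > \<bar>real s * \<alpha>'\<bar> + \<bar>S s\<bar>" using n lt by (simp add: field_simps)
  moreover have "S n < real n * \<alpha>" using n by (simp add: field_simps)
  ultimately have "S n - S s \<le> (real n - real s) * \<alpha>'" by (simp add: algebra_simps)
  then have sum_p: "(\<Sum>j<lp. \<phi> (p j)) \<le> real lp * \<alpha>'"
    using n S_shift[where m = s and k = lp] by (simp add: p_def lp_def of_nat_diff)
  have "real n' * (\<beta> - \<beta>') > K" using n' lt by (simp add: field_simps)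
  moreover have "S n' > real n' * \<beta>" using n' by (simp add: field_simps)
  ultimately have "(real n' - real s + (real e - real c)) * \<beta>' \<le> S n' - S s + (S e - S c)"
    unfolding K_def by (simp add: algebra_simps)
  moreover have "(\<Sum>j<lq. \<phi> (q j)) = (S n' - S s) + (S e - S c)"
  proof -
    have "(\<Sum>j<lq. \<phi> (q j)) = (\<Sum>j<n' - s. \<phi> (q j)) + (\<Sum>j<e - c. \<phi> (q (n' - s + j)))"
      unfolding lq_def by (rule sum_lessThan_add)
    also have "(\<Sum>j<n' - s. \<phi> (q j)) = S n' - S s"
      using n' S_shift[of s "n' - s"] by (simp add: q_def)
    also have "(\<Sum>j<e - c. \<phi> (q (n' - s + j))) = S e - S c"
      using e S_shift[of c "e - c"] by (simp add: q_def)
    finally show ?thesis .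
  qed
  moreover have lq_real: "real lq = real n' - real s + (real e - real c)"
    using e n' by (simp add: lq_def of_nat_diff)
  ultimately have sum_q: "real lq * \<beta>' \<le> (\<Sum>j<lq. \<phi> (q j))"
    using lq_real by simp
  show thesis
  proof (rule that)
    show "chain_loop f d \<kappa> u (lq * lp) (\<lambda>j. p (j mod lp))"
      by (rule chain_loop_repeat[OF loop_p cells(1) lpos(2)])
    show "chain_loop f d \<kappa> u (lq * lp) (\<lambda>j. q (j mod lq))"
      using chain_loop_repeat[OF loop_q cells(1) lpos(1)] by (simp add: mult.commute)
    show "(\<Sum>j<lq * lp. \<phi> (p (j mod lp))) \<le> real (lq * lp) * \<alpha>'"
      using mult_left_mono[OF sum_p, of "real lq"] by (simp add: sum_repeat[of "\<lambda>j. \<phi> (p j)"] mult.assoc)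
    show "real (lq * lp) * \<beta>' \<le> (\<Sum>j<lq * lp. \<phi> (q (j mod lq)))"
      using mult_left_mono[OF sum_q, of "real lp"]
      by (simp add: sum_repeat[of "\<lambda>j. \<phi> (q j)"] mult_ac mult.commute[of lq lp])
  qed
qed

lemma htop_pos_of_irregular:
  fixes f :: "'a::metric_space \<Rightarrow> 'a"
  assumes comp: "compact (UNIV :: 'a set)" and shad: "has_shadowing f" and irr: "irregular_set f \<noteq> {}"
  shows "0 < htop f"
proof -
  obtain z \<phi> where cont: "continuous_on UNIV (\<phi> :: 'a \<Rightarrow> real)"
    and nc: "\<not> convergent (\<lambda>n. (\<Sum>i<n. \<phi> ((f ^^ i) z)) / real n)"
    using irr by (auto simp: irregular_set_def irregular_for_def)
  have "bounded (range \<phi>)"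
    by (intro compact_imp_bounded compact_continuous_image cont comp)
  then obtain M where M: "\<And>x. \<bar>\<phi> x\<bar> \<le> M" by (auto simp: bounded_iff)
  have "\<bar>(\<Sum>i<n. \<phi> ((f ^^ i) z)) / real n\<bar> \<le> M" for n
  proof (cases "n = 0")
    case False
    have "\<bar>\<Sum>i<n. \<phi> ((f ^^ i) z)\<bar> \<le> (\<Sum>i<n. \<bar>\<phi> ((f ^^ i) z)\<bar>)" by (rule sum_abs)
    also have "\<dots> \<le> (\<Sum>i<n. M)" by (intro sum_mono M)
    finally show ?thesis using False by (simp add: field_simps)
  qed (use M[of z] in auto)
  then obtain \<alpha> \<beta> where \<alpha>\<beta>: "\<alpha> < \<beta>"
    and inf: "infinite {n. (\<Sum>i<n. \<phi> ((f ^^ i) z)) / real n < \<alpha>}" "infinite {n. \<beta> < (\<Sum>i<n. \<phi> ((f ^^ i) z)) / real n}"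
    using oscillation[OF _ nc] by blast
  define \<gamma> where "\<gamma> = (\<beta> - \<alpha>) / 3"
  have \<gamma>: "0 < \<gamma>" using \<alpha>\<beta> by (simp add: \<gamma>_def)
  have "uniformly_continuous_on UNIV \<phi>" by (rule compact_uniformly_continuous[OF cont comp])
  then obtain \<eta> where \<eta>: "0 < \<eta>" "\<And>x y. dist x y < \<eta> \<Longrightarrow> \<bar>\<phi> x - \<phi> y\<bar> < \<gamma>"
    unfolding uniformly_continuous_on_def using \<gamma> by (metis UNIV_I dist_real_def)
  obtain d where d: "0 < d" "\<And>x. pseudo_orbit f d x \<Longrightarrow> \<exists>y. shadowed_by f (\<eta>/4) x y"
    using shad \<eta>(1) unfolding has_shadowing_def by (metis divide_pos_pos zero_less_numeral)
  obtain \<kappa> :: "'a \<Rightarrow> 'a" where \<kappa>: "finite (range \<kappa>)" "\<And>x y. \<kappa> x = \<kappa> y \<Longrightarrow> dist x y < d"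
    using finite_cells[OF comp d(1)] by metis
  have lt: "\<alpha> < \<alpha> + \<gamma>" "\<beta> - \<gamma> < \<beta>" using \<gamma> by auto
  obtain l c p q where loops: "chain_loop f d \<kappa> c l p" "chain_loop f d \<kappa> c l q"
    and sums: "(\<Sum>j<l. \<phi> (p j)) \<le> real l * (\<alpha> + \<gamma>)" "real l * (\<beta> - \<gamma>) \<le> (\<Sum>j<l. \<phi> (q j))"
    by (rule oscillating_loops[OF \<kappa>(2,1) d(1) inf lt])
  have "\<exists>j<l. \<eta> \<le> dist (q j) (p j)"
  proof (rule ccontr)
    assume "\<not> ?thesis"
    then have "\<phi> (q j) < \<phi> (p j) + \<gamma>" if "j < l" for j
      using \<eta>(2)[of "q j" "p j"] that by fastforce
    moreover have l: "0 < l" using loops by (simp add: chain_loop_def)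
    ultimately have "(\<Sum>j<l. \<phi> (q j)) < (\<Sum>j<l. \<phi> (p j) + \<gamma>)"
      by (intro sum_strict_mono) auto
    also have "\<dots> \<le> real l * (\<alpha> + \<gamma>) + real l * \<gamma>" using sums(1) by (simp add: sum.distrib)
    also have "\<dots> = real l * (\<beta> - \<gamma>)" by (simp add: \<gamma>_def field_simps)
    finally show False using sums(2) by simp
  qed
  then obtain j where j: "j < l" "\<eta> \<le> dist (q j) (p j)" by blast
  show ?thesis
  proof (rule htop_pos_of_two_words[where p = "\<lambda>b. if b then q else p"])
    show "\<exists>y. \<forall>n. dist ((f ^^ n) y) ((if w (n div l) then q else p) (n mod l)) < \<eta>/4" for w :: "nat \<Rightarrow> bool"
      using d(2)[OF pseudo_orbit_concat[of f d \<kappa> c l "\<lambda>i. if w i then q else p"]] loops \<kappa>(2)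
      by (auto simp: shadowed_by_def)
  qed (use j \<eta> in auto)
qed

section \<open>Points that follow prescribed loops\<close>

text \<open>\<open>S i\<close> holds the loops, given by their initial points, that may be followed in the \<open>i\<close>-th block of length \<open>l\<close>.
Non-strict inequalities make the set closed.\<close>
definition coded_set :: "('a::metric_space \<Rightarrow> 'a) \<Rightarrow> nat \<Rightarrow> real \<Rightarrow> (nat \<Rightarrow> 'a set) \<Rightarrow> 'a set" where
  "coded_set f l r S = {z. \<forall>i. \<exists>p\<in>S i. \<forall>j<l. dist ((f ^^ (i * l + j)) z) ((f ^^ j) p) \<le> r}"

text \<open>The points that follow the periodic repetition of the segment of \<open>p\<close>, beginning at any phase.\<close>
definition cyclic_tracers :: "('a::metric_space \<Rightarrow> 'a) \<Rightarrow> nat \<Rightarrow> real \<Rightarrow> 'a \<Rightarrow> 'a set" where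
  "cyclic_tracers f l r p = {x. \<exists>j<l. \<forall>i. dist ((f ^^ i) x) ((f ^^ ((i + j) mod l)) p) \<le> r}"

lemma closed_coded_set:
  fixes f :: "'a::metric_space \<Rightarrow> 'a"
  assumes cont: "continuous_on UNIV f" and fin: "\<And>i. finite (S i)"
  shows "closed (coded_set f l r S)"
proof -
  have "coded_set f l r S =
      (\<Inter>i. \<Union>p\<in>S i. \<Inter>j\<in>{..<l}. {z. dist ((f ^^ (i * l + j)) z) ((f ^^ j) p) \<le> r})"
    by (rule set_eqI) (simp add: coded_set_def, simp add: Ball_def)
  moreover have "closed \<dots>"
    by (intro closed_INT closed_UN fin ballI closed_Collect_le continuous_intros continuous_on_funpow cont)
  ultimately show ?thesis by simp
qed

lemma closed_cyclic_tracers: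
  fixes f :: "'a::metric_space \<Rightarrow> 'a"
  assumes cont: "continuous_on UNIV f"
  shows "closed (cyclic_tracers f l r p)"
proof -
  have "cyclic_tracers f l r p =
      (\<Union>j\<in>{..<l}. \<Inter>i. {x. dist ((f ^^ i) x) ((f ^^ ((i + j) mod l)) p) \<le> r})"
    by (auto simp: cyclic_tracers_def)
  moreover have "closed \<dots>"
    by (intro closed_INT closed_UN finite_lessThan ballI closed_Collect_le continuous_intros continuous_on_funpow cont)
  ultimately show ?thesis by simp
qed

text \<open>A common follower of the repetitions of \<open>a\<close> and \<open>b\<close> shows that \<open>b\<close> is close to a cyclic rotation of
\<open>a\<close>. There are only \<open>l\<close> rotations, and different members of a separated set are not close to
the same one.\<close>
lemma disjoint_cyclic_tracers:
  fixes f :: "'a::metric_space \<Rightarrow> 'a"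
  assumes sep: "separated_points f l (4 * r) P" and card: "l < card P"
  obtains b where "b \<in> P" "cyclic_tracers f l r a \<inter> cyclic_tracers f l r b = {}"
proof (rule ccontr)
  assume none: "\<not> thesis"
  note found = that
  have "\<exists>s<l. \<forall>i<l. dist ((f ^^ ((i + s) mod l)) a) ((f ^^ i) b) \<le> 2 * r" if b: "b \<in> P" for b
  proof -
    obtain x where x: "x \<in> cyclic_tracers f l r a" "x \<in> cyclic_tracers f l r b"
      using found[OF b] none by blast
    obtain j where j: "j < l" "\<And>i. dist ((f ^^ i) x) ((f ^^ ((i + j) mod l)) a) \<le> r"
      using x(1) by (auto simp: cyclic_tracers_def)
    obtain k where k: "k < l" "\<And>i. dist ((f ^^ i) x) ((f ^^ ((i + k) mod l)) b) \<le> r"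
      using x(2) by (auto simp: cyclic_tracers_def)
    \<comment> \<open>Waiting \<open>l - k\<close> steps brings the phase of \<open>b\<close> to 0.\<close>
    define s where "s = (l - k + j) mod l"
    have "dist ((f ^^ ((i + s) mod l)) a) ((f ^^ i) b) \<le> 2 * r" if i: "i < l" for i
    proof -
      have "(i + (l - k) + j) mod l = (i + s) mod l" by (simp add: s_def mod_add_right_eq add.assoc)
      moreover have "(i + (l - k) + k) mod l = i" using i k(1) by simp
      ultimately show ?thesis
        using j(2)[of "i + (l - k)"] k(2)[of "i + (l - k)"]
          dist_triangle3[of "(f ^^ ((i + s) mod l)) a" "(f ^^ i) b" "(f ^^ (i + (l - k))) x"]
        by simp
    qed
    moreover have "s < l" using j(1) by (simp add: s_def)
    ultimately show ?thesis by blast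
  qed
  then obtain s where s: "\<And>b. b \<in> P \<Longrightarrow> s b < l"
      "\<And>b i. b \<in> P \<Longrightarrow> i < l \<Longrightarrow> dist ((f ^^ ((i + s b) mod l)) a) ((f ^^ i) b) \<le> 2 * r"
    by metis
  have "inj_on s P"
  proof (rule inj_onI, rule ccontr)
    fix b b' assume b: "b \<in> P" "b' \<in> P" "s b = s b'" "b \<noteq> b'"
    then obtain i where i: "i < l" "4 * r < dist ((f ^^ i) b) ((f ^^ i) b')"
      using sep unfolding separated_points_def by blast
    then show False
      using s(2)[OF b(1) i(1)] s(2)[OF b(2) i(1)] b(3)
        dist_triangle3[of "(f ^^ i) b" "(f ^^ i) b'" "(f ^^ ((i + s b) mod l)) a"]
      by simp
  qed
  then have "card P \<le> card {..<l}" using s(1) by (intro card_inj_on_le) auto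
  then show False using card by simp
qed

text \<open>By compactness: the complement of \<open>G\<close> is covered by the open sets of points that leave the
repetition of \<open>p\<close> at some time, so finitely many times suffice.\<close>
lemma long_tracing_enters:
  fixes f :: "'a::metric_space \<Rightarrow> 'a"
  assumes comp: "compact (UNIV :: 'a set)" and cont: "continuous_on UNIV f"
    and G: "open G" "cyclic_tracers f l r p \<subseteq> G"
  obtains R where "\<And>x j. j < l \<Longrightarrow> (\<And>i. i < R \<Longrightarrow> dist ((f ^^ i) x) ((f ^^ ((i + j) mod l)) p) \<le> r) \<Longrightarrow> x \<in> G"
proof -
  have "\<exists>R. \<forall>x. (\<forall>i<R. dist ((f ^^ i) x) ((f ^^ ((i + j) mod l)) p) \<le> r) \<longrightarrow> x \<in> G" if j: "j < l" for j
  proof -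
    define V where "V i = {x. r < dist ((f ^^ i) x) ((f ^^ ((i + j) mod l)) p)}" for i
    have "compact (- G)" using compact_Int_closed[OF comp, of "- G"] G(1) by auto
    moreover have "open (V i)" for i
      unfolding V_def by (intro open_Collect_less continuous_intros continuous_on_funpow cont)
    moreover have "- G \<subseteq> (\<Union>i\<in>UNIV. V i)"
      using G(2) j by (force simp: V_def cyclic_tracers_def not_le[symmetric])
    ultimately obtain C where C: "finite C" "- G \<subseteq> (\<Union>i\<in>C. V i)"
      by (metis (no_types, lifting) compactE_image)
    obtain R where "C \<subseteq> {..<R}" using finite_nat_bounded[OF C(1)] by blast
    then show ?thesis
      using C(2) by (intro exI[of _ R]) (force simp: V_def not_le[symmetric])
  qed
  then obtain R where R: "\<And>j x. j < l \<Longrightarrow> (\<forall>i<R j. dist ((f ^^ i) x) ((f ^^ ((i + j) mod l)) p) \<le> r) \<Longrightarrow> x \<in> G"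
    by metis
  show thesis
  proof (rule that[of "\<Sum>j<l. R j"])
    fix x j assume j: "j < l" and tr: "\<And>i. i < (\<Sum>j<l. R j) \<Longrightarrow> dist ((f ^^ i) x) ((f ^^ ((i + j) mod l)) p) \<le> r"
    have "R j \<le> (\<Sum>j<l. R j)" using j by (intro member_le_sum) auto
    then show "x \<in> G" using R[OF j, of x] tr by (meson less_le_trans)
  qed
qed

section \<open>Alternating runs make points irregular\<close>

text \<open>A run occupies the block positions from \<open>q * 2^k\<close> to \<open>(q + 1) * 2^k\<close>, so the average up to its end
is a convex combination of the average up to its start, with weight \<open>q / (q + 1)\<close>, and the average over
the run. If the first two converge to \<open>c\<close>, so does the average over the run, whatever happens outside
the runs. On the run, all but the last \<open>R\<close> values of \<open>\<phi>\<close> are at most \<open>\<gamma>\<close>.\<close>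
lemma limit_le_of_runs:
  fixes f :: "'a::metric_space \<Rightarrow> 'a" and \<phi> :: "'a \<Rightarrow> real"
  assumes lim: "(\<lambda>n. (\<Sum>i<n. \<phi> ((f ^^ i) z)) / real n) \<longlonglongrightarrow> c"
    and \<phi>: "\<And>x. \<phi> x \<le> 1" and \<gamma>: "-1 \<le> \<gamma>" and l: "0 < l" and q: "0 < q"
    and R: "\<And>x j. j < l \<Longrightarrow> (\<And>i. i < R \<Longrightarrow> dist ((f ^^ i) x) ((f ^^ ((i + j) mod l)) p) \<le> r) \<Longrightarrow> \<phi> x \<le> \<gamma>"
    and K: "infinite K"
    and runs: "\<And>k i j. k \<in> K \<Longrightarrow> q * 2 ^ k \<le> i \<Longrightarrow> i < (q + 1) * 2 ^ k \<Longrightarrow> j < l \<Longrightarrow>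
                 dist ((f ^^ (i * l + j)) z) ((f ^^ j) p) \<le> r"
  shows "c \<le> \<gamma>"
proof (rule ccontr)
  assume "\<not> c \<le> \<gamma>"
  define A where "A n = (\<Sum>i<n. \<phi> ((f ^^ i) z)) / real n" for n
  define D where "D k = real (q + 1) * A ((q + 1) * l * 2 ^ k) - real q * A (q * l * 2 ^ k) - 2 * real R / (real l * 2 ^ k)" for k
  have "D k \<le> \<gamma>" if k: "k \<in> K" for k
  proof -
    define m n where "m = l * 2 ^ k" and "n = q * m"
    have m: "0 < m" using l by (simp add: m_def)
    \<comment> \<open>Near the end of the run only \<open>\<phi> \<le> 1 \<le> \<gamma> + 2\<close> is available.\<close>
    have bound: "\<phi> ((f ^^ (n + j)) z) \<le> \<gamma> + 2 * of_bool (m \<le> j + R)" if j: "j < m" for j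
    proof (cases "m \<le> j + R")
      case True then show ?thesis using \<phi>[of "(f ^^ (n + j)) z"] \<gamma> by simp
    next
      case False
      have "\<phi> ((f ^^ (n + j)) z) \<le> \<gamma>"
      proof (rule R)
        show "j mod l < l" using l by simp
        fix i assume i: "i < R"
        define s where "s = q * 2 ^ k + (i + j) div l"
        have "(i + j) div l < 2 ^ k"
          using False i by (intro less_mult_imp_div_less) (simp add: m_def mult.commute)
        then have s: "q * 2 ^ k \<le> s" "s < (q + 1) * 2 ^ k" by (auto simp: s_def)
        have "i + (n + j) = q * 2 ^ k * l + (i + j)" by (simp add: n_def m_def)
        also have "\<dots> = s * l + (i + j) mod l" by (simp add: s_def add_mult_distrib)
        finally have "(f ^^ i) ((f ^^ (n + j)) z) = (f ^^ (s * l + (i + j) mod l)) z"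
          by (metis funpow_add o_apply)
        moreover have "(i + j mod l) mod l = (i + j) mod l" by (rule mod_add_right_eq)
        ultimately show "dist ((f ^^ i) ((f ^^ (n + j)) z)) ((f ^^ ((i + j mod l) mod l)) p) \<le> r"
          using runs[OF k s, of "(i + j) mod l"] l by simp
      qed
      then show ?thesis using False by simp
    qed
    have "(\<Sum>i<n + m. \<phi> ((f ^^ i) z)) - (\<Sum>i<n. \<phi> ((f ^^ i) z)) = (\<Sum>j<m. \<phi> ((f ^^ (n + j)) z))"
      by (simp add: sum_lessThan_add)
    also have "\<dots> \<le> (\<Sum>j<m. \<gamma> + 2 * of_bool (m \<le> j + R))" using bound by (intro sum_mono) auto
    also have "\<dots> = real m * \<gamma> + 2 * real (card {j\<in>{..<m}. m \<le> j + R})"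
      by (simp add: sum.distrib sum_distrib_left[symmetric] of_bool_def sum.If_cases Int_def)
    also have "card {j\<in>{..<m}. m \<le> j + R} \<le> card {m - R..<m}" by (intro card_mono) auto
    then have "real m * \<gamma> + 2 * real (card {j\<in>{..<m}. m \<le> j + R}) \<le> real m * \<gamma> + 2 * real R" by simp
    finally have "(\<Sum>i<n + m. \<phi> ((f ^^ i) z)) - (\<Sum>i<n. \<phi> ((f ^^ i) z)) \<le> real m * \<gamma> + 2 * real R" .
    moreover have "real (q + 1) * real m = real (n + m)" by (simp add: n_def algebra_simps)
    then have "(\<Sum>i<n + m. \<phi> ((f ^^ i) z)) = real (q + 1) * real m * A (n + m)"
      using m by (simp add: A_def)
    moreover have "(\<Sum>i<n. \<phi> ((f ^^ i) z)) = real q * real m * A n"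
      using m q by (simp add: A_def n_def)
    ultimately have "real (q + 1) * A (n + m) - real q * A n - 2 * real R / real m \<le> \<gamma>"
      using m by (simp add: field_simps)
    moreover have "n + m = (q + 1) * l * 2 ^ k" "n = q * l * 2 ^ k" "real m = real l * 2 ^ k"
      by (simp_all add: n_def m_def algebra_simps)
    ultimately show ?thesis by (simp only: D_def)
  qed
  moreover have "D \<longlonglongrightarrow> real (q + 1) * c - real q * c - 0"
  proof -
    have top: "filterlim (\<lambda>k. t * 2 ^ k) sequentially sequentially" if "0 < t" for t :: nat
    proof (rule filterlim_subseq)
      show "strict_mono (\<lambda>k. t * 2 ^ k)" using that by (auto simp: strict_mono_Suc_iff)
    qed
    have "(\<lambda>k. A (t * 2 ^ k)) \<longlonglongrightarrow> c" if "0 < t" for t :: nat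
      using filterlim_compose[OF lim[folded A_def] top[OF that]] .
    moreover have "(\<lambda>k. 2 * real R / real l * (1/2) ^ k) \<longlonglongrightarrow> 2 * real R / real l * 0"
      by (intro tendsto_intros LIMSEQ_power_zero) auto
    then have "(\<lambda>k. 2 * real R / (real l * 2 ^ k)) \<longlonglongrightarrow> 0"
      by (simp add: power_divide)
    ultimately show ?thesis
      unfolding D_def using l q by (intro tendsto_diff tendsto_mult tendsto_const) auto
  qed
  then have "D \<longlonglongrightarrow> c" by (simp add: algebra_simps)
  then have "\<forall>\<^sub>F k in sequentially. \<gamma> < D k" using \<open>\<not> c \<le> \<gamma>\<close> by (intro order_tendstoD) auto
  then obtain N where "\<And>k. N \<le> k \<Longrightarrow> \<gamma> < D k" by (auto simp: eventually_sequentially)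
  moreover obtain k where "k \<in> K" "N \<le> k" using K by (auto simp: infinite_nat_iff_unbounded_le)
  ultimately show False by force
qed

section \<open>Entropy of a set of coded points\<close>

text \<open>A Bowen ball of length \<open>u\<close> determines the first \<open>u div l\<close> loops of the coded points in it. Count the
words of some large length \<open>L\<close>: a ball of length \<open>u\<close> accounts for at most the fraction
\<open>1 / (\<Prod>i<u div l. card (S i))\<close> of them, which is at most \<open>exp (- t u) / c\<close> if \<open>c > 0\<close>, and together the balls
account for all words.\<close>
lemma sum_cover_ge:
  fixes f :: "'a::metric_space \<Rightarrow> 'a"
  assumes sep: "separated_points f l (4 * r) P"
    and S: "\<And>i. S i \<subseteq> P" "\<And>i. finite (S i)" "\<And>i. S i \<noteq> {}"
    and trace: "\<And>w. (\<And>i. w i \<in> P) \<Longrightarrow> \<exists>z. \<forall>i. \<forall>j<l. dist ((f ^^ (i * l + j)) z) ((f ^^ j) (w i)) \<le> r"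
    and growth: "\<And>u. c * exp (t * real u) \<le> (\<Prod>i<u div l. real (card (S i)))"
    and F: "finite F" "\<And>u x. (u, x) \<in> F \<Longrightarrow> 0 < u" "coded_set f l r S \<subseteq> (\<Union>(u, x)\<in>F. bowen_ball f u x r)"
  shows "c \<le> (\<Sum>(u, x)\<in>F. exp (- t * real u))"
proof -
  define W where "W L = (\<Pi>\<^sub>E i\<in>{..<L}. S i)" for L
  define N where "N k = (\<Prod>i<k. real (card (S i)))" for k
  have N_pos: "0 < N k" for k
    unfolding N_def using S by (intro prod_pos) (auto simp: card_gt_0_iff)
  define L where "L = (\<Sum>b\<in>F. fst b)"
  have L: "u div l \<le> L" if "(u, x) \<in> F" for u x
  proof -
    have "u \<le> L" unfolding L_def using member_le_sum[OF that, of fst] F(1) by simp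
    then show ?thesis using div_le_dividend order_trans by blast
  qed
  have "\<exists>z b. z \<in> coded_set f l r S \<and> (\<forall>i<L. \<forall>j<l. dist ((f ^^ (i * l + j)) z) ((f ^^ j) (v i)) \<le> r) \<and>
      b \<in> F \<and> z \<in> bowen_ball f (fst b) (snd b) r" if v: "v \<in> W L" for v
  proof -
    define w where "w i = (if i < L then v i else (SOME p. p \<in> S i))" for i
    have w: "w i \<in> S i" for i
      using v S(3)[of i] by (auto simp: w_def W_def PiE_iff some_in_eq)
    then obtain z where z: "\<And>i j. j < l \<Longrightarrow> dist ((f ^^ (i * l + j)) z) ((f ^^ j) (w i)) \<le> r"
      using trace[of w] S(1) by blast
    have "z \<in> coded_set f l r S" using z w unfolding coded_set_def by blast
    moreover from this obtain b where "b \<in> F" "z \<in> bowen_ball f (fst b) (snd b) r"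
      using F(3) by fastforce
    moreover have "\<forall>i<L. \<forall>j<l. dist ((f ^^ (i * l + j)) z) ((f ^^ j) (v i)) \<le> r"
    proof (intro allI impI)
      fix i j assume "i < L" "j < l"
      then show "dist ((f ^^ (i * l + j)) z) ((f ^^ j) (v i)) \<le> r"
        using z[of j i] by (simp add: w_def)
    qed
    ultimately show ?thesis by blast
  qed
  then obtain z b where z: "\<And>v i j. v \<in> W L \<Longrightarrow> i < L \<Longrightarrow> j < l \<Longrightarrow> dist ((f ^^ (i * l + j)) (z v)) ((f ^^ j) (v i)) \<le> r"
    and b: "\<And>v. v \<in> W L \<Longrightarrow> b v \<in> F" "\<And>v. v \<in> W L \<Longrightarrow> z v \<in> bowen_ball f (fst (b v)) (snd (b v)) r"
    by metis
  have finW: "finite (W L)" unfolding W_def using S(2) by (intro finite_PiE) auto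
  have fibre: "real (card {v\<in>W L. b v = (u, x)}) \<le> N L / N (u div l)" if ux: "(u, x) \<in> F" for u x
  proof -
    let ?V = "{v\<in>W L. b v = (u, x)}" and ?k = "u div l"
    have agree: "v i = v' i" if v: "v \<in> ?V" "v' \<in> ?V" and i: "i < ?k" for v v' i
    proof (rule ccontr)
      assume "v i \<noteq> v' i"
      moreover have iL: "i < L" using i L[OF ux] by simp
      then have "v i \<in> P" "v' i \<in> P" using v S(1) by (auto simp: W_def PiE_iff)
      ultimately obtain j where j: "j < l" "4 * r < dist ((f ^^ j) (v i)) ((f ^^ j) (v' i))"
        using sep unfolding separated_points_def by blast
      define n where "n = i * l + j"
      have "n < Suc i * l" using j by (simp add: n_def)
      also have "\<dots> \<le> u div l * l" using i by (intro mult_le_mono1) simp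
      also have "\<dots> \<le> u" by simp
      finally have n: "n < u" .
      have "z v \<in> bowen_ball f u x r" "z v' \<in> bowen_ball f u x r" using b(2)[of v] b(2)[of v'] v by auto
      then have "dist ((f ^^ n) x) ((f ^^ n) (z v)) < r" "dist ((f ^^ n) x) ((f ^^ n) (z v')) < r"
        using n F(2)[OF ux] by (auto simp: bowen_ball_def bowen_dist_less_iff)
      moreover have "dist ((f ^^ n) (z v)) ((f ^^ j) (v i)) \<le> r" "dist ((f ^^ n) (z v')) ((f ^^ j) (v' i)) \<le> r"
        using z[of v i j] z[of v' i j] v iL j by (auto simp: n_def)
      moreover note dist_triangle3[of "(f ^^ n) (z v)" "(f ^^ n) (z v')" "(f ^^ n) x"]
        dist_triangle3[of "(f ^^ j) (v i)" "(f ^^ n) (z v')" "(f ^^ n) (z v)"]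
        dist_triangle[of "(f ^^ j) (v i)" "(f ^^ j) (v' i)" "(f ^^ n) (z v')"]
      ultimately show False using j(2) by linarith
    qed
    have inj: "inj_on (\<lambda>v. restrict v {?k..<L}) ?V"
    proof (rule inj_onI)
      fix v v' assume v: "v \<in> ?V" "v' \<in> ?V" and eq: "restrict v {?k..<L} = restrict v' {?k..<L}"
      show "v = v'"
      proof
        fix i show "v i = v' i"
        proof (cases "i < ?k")
          case True then show ?thesis using agree v by blast
        next
          case False
          then show ?thesis
            using fun_cong[OF eq, of i] v by (cases "i < L") (auto simp: W_def PiE_iff extensional_def)
        qed
      qed
    qed
    have "card ?V \<le> card (\<Pi>\<^sub>E i\<in>{?k..<L}. S i)"
      using S(2) by (intro card_inj_on_le[OF inj] finite_PiE) (auto simp: W_def)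
    then have "real (card ?V) \<le> (\<Prod>i\<in>{?k..<L}. real (card (S i)))"
      by (simp add: card_PiE of_nat_prod[symmetric] del: of_nat_prod)
    also have "\<dots> = N L / N ?k"
    proof -
      have "N ?k * (\<Prod>i\<in>{?k..<L}. real (card (S i))) = N L"
        using prod.atLeastLessThan_concat[of 0 ?k L "\<lambda>i. real (card (S i))"] L[OF ux]
        by (simp add: N_def lessThan_atLeast0)
      then show ?thesis using N_pos[of ?k] by (simp add: field_simps)
    qed
    finally show ?thesis .
  qed
  have "N L = real (card (W L))" by (simp add: N_def W_def card_PiE)
  also have "card (W L) = (\<Sum>d\<in>F. card {v\<in>W L. b v = d})"
    using sum.group[OF finW F(1), of b "\<lambda>_. 1::nat"] b(1) by (simp add: image_subset_iff)
  also have "real \<dots> = (\<Sum>(u, x)\<in>F. real (card {v\<in>W L. b v = (u, x)}))"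
    by (simp add: case_prod_beta)
  also have "\<dots> \<le> (\<Sum>(u, x)\<in>F. N L / N (u div l))"
    using fibre by (intro sum_mono) auto
  finally have "N L \<le> N L * (\<Sum>(u, x)\<in>F. 1 / N (u div l))"
    by (simp add: sum_distrib_left case_prod_beta)
  then have one: "1 \<le> (\<Sum>(u, x)\<in>F. 1 / N (u div l))" using N_pos[of L] by simp
  show ?thesis
  proof (cases "0 < c")
    case True
    have "c * (1 / N (u div l)) \<le> exp (- t * real u)" for u
      using growth[of u] N_pos[of "u div l"] by (simp add: N_def[symmetric] exp_minus field_simps)
    then have "c * (\<Sum>(u, x)\<in>F. 1 / N (u div l)) \<le> (\<Sum>(u, x)\<in>F. exp (- t * real u))"
      unfolding sum_distrib_left by (intro sum_mono) (auto simp: case_prod_beta)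
    moreover have "c \<le> c * (\<Sum>(u, x)\<in>F. 1 / N (u div l))" using True one by simp
    ultimately show ?thesis by linarith
  next
    case False
    then show ?thesis by (smt (verit) case_prod_beta exp_ge_zero sum_nonneg)
  qed
qed

text \<open>The coded points form a compact set and Bowen balls of positive length are open, so every countable
cover contains a finite one, whose weight \<open>sum_cover_ge\<close> bounds from below.\<close>
lemma htop_on_eps_ge:
  fixes f :: "'a::metric_space \<Rightarrow> 'a"
  assumes comp: "compact (UNIV :: 'a set)" and cont: "continuous_on UNIV f"
    and sep: "separated_points f l (4 * r) P"
    and S: "\<And>i. S i \<subseteq> P" "\<And>i. finite (S i)" "\<And>i. S i \<noteq> {}"
    and trace: "\<And>w. (\<And>i. w i \<in> P) \<Longrightarrow> \<exists>z. \<forall>i. \<forall>j<l. dist ((f ^^ (i * l + j)) z) ((f ^^ j) (w i)) \<le> r"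
    and growth: "\<And>u. c * exp (h * real u) \<le> (\<Prod>i<u div l. real (card (S i)))" and c: "0 < c"
    and E: "coded_set f l r S \<subseteq> E"
  shows "ereal h \<le> htop_on_eps f E r"
  unfolding htop_on_eps_def
proof (rule Inf_greatest, clarify)
  fix t assume t: "bowen_C f E t r = 0"
  show "ereal h \<le> ereal t"
  proof (rule ccontr)
    assume "\<not> ereal h \<le> ereal t"
    then have "t < h" by simp
    have growth_t: "c * exp (t * real u) \<le> (\<Prod>i<u div l. real (card (S i)))" for u
    proof -
      have "c * exp (t * real u) \<le> c * exp (h * real u)"
        using c \<open>t < h\<close> by (intro mult_left_mono) (auto intro!: mult_right_mono)
      also note growth
      finally show ?thesis .
    qed
    have "ennreal c \<le> (\<Sum>\<^sub>\<infinity>(u, x)\<in>Q. ennreal (exp (- t * real u)))" if Q: "Q \<in> bowen_covers f E 1 r" for Q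
    proof -
      have pos: "0 < u" if "(u, x) \<in> Q" for u x
        using Q that by (fastforce simp: bowen_covers_def)
      have "compact (coded_set f l r S)"
        using compact_Int_closed[OF comp closed_coded_set[OF cont S(2)]] by simp
      moreover have "open (case b of (u, x) \<Rightarrow> bowen_ball f u x r)" if "b \<in> Q" for b
      proof -
        obtain u x where "b = (u, x)" by (cases b)
        then show ?thesis using pos that by (simp add: bowen_ball_open[OF cont])
      qed
      moreover have "coded_set f l r S \<subseteq> (\<Union>b\<in>Q. case b of (u, x) \<Rightarrow> bowen_ball f u x r)"
        using Q E by (auto simp: bowen_covers_def)
      ultimately obtain F where F: "F \<subseteq> Q" "finite F"
          "coded_set f l r S \<subseteq> (\<Union>b\<in>F. case b of (u, x) \<Rightarrow> bowen_ball f u x r)"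
        by (rule compactE_image)
      have "c \<le> (\<Sum>(u, x)\<in>F. exp (- t * real u))"
        by (rule sum_cover_ge[OF sep S trace growth_t F(2) _ F(3)]) (use pos F(1) in auto)
      then have "ennreal c \<le> ennreal (\<Sum>(u, x)\<in>F. exp (- t * real u))" by (rule ennreal_leI)
      also have "\<dots> = (\<Sum>(u, x)\<in>F. ennreal (exp (- t * real u)))"
        by (subst sum_ennreal[symmetric]) (auto simp: case_prod_beta)
      also have "\<dots> = (\<Sum>\<^sub>\<infinity>(u, x)\<in>F. ennreal (exp (- t * real u)))"
        using F(2) by simp
      also have "\<dots> \<le> (\<Sum>\<^sub>\<infinity>(u, x)\<in>Q. ennreal (exp (- t * real u)))"
        using F(1) by (intro infsum_mono_neutral nonneg_summable_on_complete) auto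
      finally show ?thesis .
    qed
    then have "ennreal c \<le> bowen_C_n f E t 1 r" unfolding bowen_C_n_def by (intro INF_greatest)
    also have "\<dots> \<le> bowen_C f E t r" unfolding bowen_C_eq_SUP by (intro SUP_upper) auto
    finally show False using t c by simp
  qed
qed

lemma run_index_unique:
  assumes "q * 2 ^ k \<le> i" "i < (q + 1) * 2 ^ k" "q * 2 ^ k' \<le> i" "i < (q + 1) * 2 ^ k'" "0 < (q::nat)"
  shows "k = k'"
proof -
  have False if "q * 2 ^ k' \<le> i" "i < (q + 1) * 2 ^ k" "k < k'" for k k' :: nat
  proof -
    have "(2::nat) ^ Suc k \<le> 2 ^ k'" using that by (intro power_increasing) auto
    then have "q * (2 * 2 ^ k) \<le> q * 2 ^ k'" by simp
    moreover have "(q + 1) * 2 ^ k \<le> q * (2 * 2 ^ k)" using assms(5) by simp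
    ultimately show False using that by linarith
  qed
  from this[of k' k] this[of k k'] show ?thesis using assms by (metis linorder_neqE_nat)
qed

text \<open>A run has length \<open>2^k\<close>, and the runs that begin before \<open>n\<close> have lengths that sum to less than twice the
longest, while the longest is less than \<open>n / q\<close>.\<close>
lemma card_runs_le:
  assumes q: "0 < (q::nat)"
  shows "q * card {i. i < n \<and> (\<exists>k. q * 2 ^ k \<le> i \<and> i < (q + 1) * 2 ^ k)} \<le> 2 * n"
proof -
  let ?M = "{i. i < n \<and> (\<exists>k. q * 2 ^ k \<le> i \<and> i < (q + 1) * 2 ^ k)}"
  have "n \<le> q * 2 ^ n" using q less_exp[of n] by (metis less_imp_le mult_le_mono nat_mult_1 Suc_leI One_nat_def)
  then have ex: "\<exists>m. n \<le> q * 2 ^ m" by blast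
  define m where "m = (LEAST m. n \<le> q * 2 ^ m)"
  have m: "n \<le> q * 2 ^ m" unfolding m_def by (rule LeastI_ex[OF ex])
  have sub: "?M \<subseteq> (\<Union>k\<in>{..<m}. {q * 2 ^ k..<(q + 1) * 2 ^ k})"
  proof
    fix i assume "i \<in> ?M"
    then obtain k where k: "i < n" "q * 2 ^ k \<le> i" "i < (q + 1) * 2 ^ k" by blast
    then have "q * 2 ^ k < q * 2 ^ m" using m by linarith
    then have "k < m" using q by simp
    then show "i \<in> (\<Union>k\<in>{..<m}. {q * 2 ^ k..<(q + 1) * 2 ^ k})" using k by auto
  qed
  have "card ?M \<le> card (\<Union>k\<in>{..<m}. {q * 2 ^ k..<(q + 1) * 2 ^ k})" by (intro card_mono sub) auto
  also have "\<dots> \<le> (\<Sum>k<m. card {q * 2 ^ k..<(q + 1) * 2 ^ k})" by (intro card_UN_le) auto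
  also have "\<dots> = (\<Sum>k<m. 2 ^ k)" by simp
  also have "\<dots> = 2 ^ m - 1" by (induction m) auto
  finally have M: "card ?M \<le> 2 ^ m - 1" .
  show ?thesis
  proof (cases m)
    case 0
    then have "card ?M = 0" using M by simp
    then show ?thesis by (simp only: mult_0_right)
  next
    case (Suc m')
    then have "\<not> n \<le> q * 2 ^ m'" unfolding m_def by (intro not_less_Least) simp
    moreover have "q * card ?M \<le> q * 2 ^ m" using M by (intro mult_le_mono2) simp
    moreover have "q * 2 ^ m = 2 * (q * 2 ^ m')" by (simp add: Suc)
    ultimately show ?thesis by linarith
  qed
qed

text \<open>Urysohn's function, in its explicit form for metric spaces.\<close>
lemma separating_function:
  fixes A B :: "'a::metric_space set"
  assumes "closed A" "closed B" "A \<noteq> {}" "B \<noteq> {}" "A \<inter> B = {}"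
  obtains \<phi> :: "'a \<Rightarrow> real" where "continuous_on UNIV \<phi>" "\<And>x. 0 \<le> \<phi> x" "\<And>x. \<phi> x \<le> 1"
    "\<And>x. x \<in> A \<Longrightarrow> \<phi> x = 0" "\<And>x. x \<in> B \<Longrightarrow> \<phi> x = 1"
proof -
  define \<phi> where "\<phi> x = infdist x A / (infdist x A + infdist x B)" for x
  have zero: "infdist x A = 0 \<longleftrightarrow> x \<in> A" "infdist x B = 0 \<longleftrightarrow> x \<in> B" for x
    using assms in_closed_iff_infdist_zero by blast+
  have nz: "infdist x A + infdist x B \<noteq> 0" for x
    using zero[of x] assms(5) infdist_nonneg[of x A] infdist_nonneg[of x B] by (metis IntI add_nonneg_eq_0_iff empty_iff)
  show thesis
  proof (rule that[of \<phi>])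
    show "continuous_on UNIV \<phi>" unfolding \<phi>_def using nz by (intro continuous_intros) auto
    show "\<phi> x = 0" if "x \<in> A" for x using zero that by (simp add: \<phi>_def)
    show "\<phi> x = 1" if "x \<in> B" for x using zero nz[of x] that by (simp add: \<phi>_def)
    fix x
    have "0 \<le> infdist x A" "0 \<le> infdist x B" by (rule infdist_nonneg)+
    then show "0 \<le> \<phi> x" "\<phi> x \<le> 1" unfolding \<phi>_def using nz[of x] by (auto simp: field_simps)
  qed
qed

text \<open>Positions in runs may offer a single choice, all others offer \<open>N \<ge> exp (h' l)\<close> choices. By
\<open>card_runs_le\<close> the runs cost at most the proportion \<open>2 / q\<close> of the exponent; the factor \<open>exp (- h l)\<close> makes up for the incomplete
last block of \<open>u\<close>.\<close>
lemma prod_free_choices_ge: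
  fixes card_S :: "nat \<Rightarrow> real"
  assumes q: "0 < q" and h: "0 \<le> h" "h \<le> h' * (1 - 2 / real q)" and l: "0 < l" and h': "0 < h'"
    and N: "exp (h' * real l) \<le> N"
    and free: "\<And>i. \<not> (\<exists>k. q * 2 ^ k \<le> i \<and> i < (q + 1) * 2 ^ k) \<Longrightarrow> card_S i = N"
    and ge1: "\<And>i. 1 \<le> card_S i"
  shows "exp (- h * real l) * exp (h * real u) \<le> (\<Prod>i<u div l. card_S i)"
proof -
  define n where "n = u div l"
  define M where "M = {i. i < n \<and> (\<exists>k. q * 2 ^ k \<le> i \<and> i < (q + 1) * 2 ^ k)}"
  have M: "M \<subseteq> {..<n}" by (auto simp: M_def)
  have "real (q * card M) \<le> real (2 * n)"
    unfolding M_def by (intro of_nat_mono card_runs_le[OF q])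
  then have few: "real (card M) \<le> 2 / real q * real n" using q by (simp add: field_simps)
  have cardM: "card M \<le> n" using card_mono[OF _ M] by simp
  have "u < l * n + l" using mod_less_divisor[OF l, of u] mult_div_mod_eq[of l u] unfolding n_def by linarith
  then have "real u \<le> real (l * n + l)" by (intro of_nat_mono) simp
  then have "real u \<le> real l * real n + real l" by simp
  then have "- h * real l + h * real u \<le> h * (real l * real n)"
    using mult_left_mono[of "real u" "real l * real n + real l" h] h(1) by (simp add: algebra_simps)
  also have "\<dots> \<le> h' * (1 - 2 / real q) * (real l * real n)"
    using h(2) by (intro mult_right_mono) auto
  also have "\<dots> = h' * real l * (real n - 2 / real q * real n)" by (simp add: algebra_simps)
  also have "\<dots> \<le> h' * real l * (real n - real (card M))"
    using few h' by (intro mult_left_mono) auto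
  also have "\<dots> = real (n - card M) * (h' * real l)" using cardM by (simp add: of_nat_diff)
  finally have "exp (- h * real l) * exp (h * real u) \<le> exp (real (n - card M) * (h' * real l))"
    by (simp add: exp_add[symmetric])
  also have "\<dots> = exp (h' * real l) ^ (n - card M)" by (simp add: exp_of_nat_mult)
  also have "\<dots> \<le> N ^ (n - card M)" using N by (intro power_mono) auto
  also have "\<dots> = (\<Prod>i\<in>{..<n} - M. card_S i)"
  proof -
    have "(\<Prod>i\<in>{..<n} - M. card_S i) = (\<Prod>i\<in>{..<n} - M. N)"
      by (intro prod.cong refl free) (auto simp: M_def)
    then show ?thesis using M by (simp add: card_Diff_subset finite_subset[OF M])
  qed
  also have "\<dots> \<le> (\<Prod>i\<in>{..<n} - M. card_S i) * (\<Prod>i\<in>M. card_S i)"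
  proof -
    have "1 \<le> (\<Prod>i\<in>M. card_S i)" using ge1 by (intro prod_ge_1)
    moreover have "0 \<le> (\<Prod>i\<in>{..<n} - M. card_S i)" using ge1 by (intro prod_nonneg ballI) (meson order_trans zero_le_one)
    ultimately show ?thesis by (simp add: mult_le_cancel_left1)
  qed
  also have "\<dots> = (\<Prod>i<n. card_S i)" by (rule prod.subset_diff[OF M, symmetric]) simp
  finally show ?thesis by (simp add: n_def)
qed

section \<open>The irregular set has full entropy\<close>

lemma irregular_entropy_ge:
  fixes f :: "'a::metric_space \<Rightarrow> 'a"
  assumes comp: "compact (UNIV :: 'a set)" and cont: "continuous_on UNIV f" and shad: "has_shadowing f"
    and h: "0 \<le> h" "ereal h < htop f"
  obtains r where "0 < r" "ereal h \<le> htop_on_eps f (irregular_set f) r"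
proof -
  obtain h' where h': "h < h'" "ereal h' < htop f" using ereal_dense2[OF h(2)] by auto
  then have h'_pos: "0 < h'" using h by simp
  obtain e where e: "0 < e" "ereal h' < htop_eps f e"
    using h'(2) by (auto simp: htop_eq_SUP less_SUP_iff)
  \<comment> \<open>Comparing two loops through two shadowing points and the centre of a Bowen ball costs \<open>4 * r\<close>,
    which must not exceed the separation \<open>e / 2\<close> of the loops.\<close>
  define r where "r = e / 8"
  have r: "0 < r" "4 * r = e / 2" using e by (auto simp: r_def)
  obtain \<delta> where \<delta>: "0 < \<delta>" "\<And>x. pseudo_orbit f \<delta> x \<Longrightarrow> \<exists>y. shadowed_by f r x y"
    using shad r(1) unfolding has_shadowing_def by metis
  define d where "d = min \<delta> e"
  have "0 < d" using \<delta> e by (simp add: d_def)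
  then obtain \<kappa> :: "'a \<Rightarrow> 'a" where \<kappa>: "finite (range \<kappa>)" "\<And>x y. \<kappa> x = \<kappa> y \<Longrightarrow> dist x y < d"
    using finite_cells[OF comp] by metis
  have \<kappa>_e: "dist x y < e" if "\<kappa> x = \<kappa> y" for x y using \<kappa>(2)[OF that] by (simp add: d_def)
  have \<kappa>_\<delta>: "dist x y < \<delta>" if "\<kappa> x = \<kappa> y" for x y using \<kappa>(2)[OF that] by (simp add: d_def)
  \<comment> \<open>This \<open>C\<close> makes \<open>C * exp (h' * l) \<ge> l\<close>, hence more loops than cyclic rotations.\<close>
  define C where "C = max 1 (1 / h')"
  have C: "1 \<le> C" "1 \<le> C * h'" using h'_pos by (auto simp: C_def max_def field_simps)
  obtain l c P where P: "finite P" "P \<subseteq> {x. \<kappa> x = c \<and> \<kappa> ((f ^^ l) x) = c}"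
      "separated_points f l (e/2) P" "C * exp (h' * real l) < real (card P)"
    by (rule loops_of_positive_entropy[OF \<kappa>_e \<kappa>(1) e(1) C(1) less_imp_le[OF h'_pos] e(2)])
  have sep: "separated_points f l (4 * r) P" unfolding r(2) by (rule P(3))
  have N: "exp (h' * real l) \<le> real (card P)"
  proof -
    have "1 * exp (h' * real l) \<le> C * exp (h' * real l)" using C(1) by (rule mult_right_mono) simp
    then show ?thesis using P(4) by linarith
  qed
  have card: "l < card P"
  proof -
    have "h' * real l \<le> exp (h' * real l)" using exp_ge_add_one_self[of "h' * real l"] by linarith
    then have le_exp: "C * (h' * real l) \<le> C * exp (h' * real l)" using C(1) by (intro mult_left_mono) auto
    have "real l \<le> C * h' * real l" using mult_right_mono[OF C(2), of "real l"] by simp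
    also have "\<dots> \<le> C * exp (h' * real l)"
      using le_exp by (simp only: mult.assoc)
    also note P(4)
    finally show ?thesis by simp
  qed
  have l: "0 < l"
  proof (rule ccontr)
    assume "\<not> 0 < l"
    then have "\<forall>x\<in>P. \<forall>y\<in>P. x = y" using P(3) by (auto simp: separated_points_def)
    then have "card P \<le> 1" using card_le_Suc0_iff_eq[OF P(1)] by simp
    moreover have "1 < real (card P)" using P(4) C(1) \<open>\<not> 0 < l\<close> by simp
    ultimately show False by simp
  qed
  have trace: "\<exists>z. \<forall>i. \<forall>j<l. dist ((f ^^ (i * l + j)) z) ((f ^^ j) (w i)) \<le> r" if w: "\<And>i. w i \<in> P" for w
  proof -
    have loop: "chain_loop f \<delta> \<kappa> c l (\<lambda>j. (f ^^ j) (w i))" for i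
    proof -
      have "f ((f ^^ (l - 1)) (w i)) = (f ^^ l) (w i)" using l by (cases l) auto
      then show ?thesis using w[of i] P(2) l \<delta>(1) by (auto simp: chain_loop_def)
    qed
    have "pseudo_orbit f \<delta> (\<lambda>n. (f ^^ (n mod l)) (w (n div l)))"
      using pseudo_orbit_concat[where w = "\<lambda>i j. (f ^^ j) (w i)", OF loop \<kappa>_\<delta>] by simp
    then obtain z where "shadowed_by f r (\<lambda>n. (f ^^ (n mod l)) (w (n div l))) z" using \<delta>(2) by blast
    then have z: "dist ((f ^^ n) z) ((f ^^ (n mod l)) (w (n div l))) < r" for n
      by (simp add: shadowed_by_def)
    have "dist ((f ^^ (i * l + j)) z) ((f ^^ j) (w i)) \<le> r" if "j < l" for i j
      using z[of "i * l + j"] that by simp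
    then show ?thesis by blast
  qed
  have nonempty: "cyclic_tracers f l r p \<noteq> {}" if p: "p \<in> P" for p
  proof -
    obtain z where z: "\<And>i j. j < l \<Longrightarrow> dist ((f ^^ (i * l + j)) z) ((f ^^ j) p) \<le> r"
      using trace[of "\<lambda>_. p"] p by blast
    have "dist ((f ^^ n) z) ((f ^^ (n mod l)) p) \<le> r" for n
      using z[of "n mod l" "n div l"] l by simp
    then have "z \<in> cyclic_tracers f l r p" using l by (auto simp: cyclic_tracers_def intro!: exI[of _ 0])
    then show ?thesis by blast
  qed
  have "P \<noteq> {}" using card by auto
  then obtain a where a: "a \<in> P" by blast
  obtain b where b: "b \<in> P" "cyclic_tracers f l r a \<inter> cyclic_tracers f l r b = {}"
    using disjoint_cyclic_tracers[OF sep card] .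
  obtain \<phi> :: "'a \<Rightarrow> real" where \<phi>: "continuous_on UNIV \<phi>" "\<And>x. 0 \<le> \<phi> x" "\<And>x. \<phi> x \<le> 1"
      "\<And>x. x \<in> cyclic_tracers f l r a \<Longrightarrow> \<phi> x = 0" "\<And>x. x \<in> cyclic_tracers f l r b \<Longrightarrow> \<phi> x = 1"
    by (rule separating_function[OF closed_cyclic_tracers[OF cont] closed_cyclic_tracers[OF cont]
          nonempty[OF a] nonempty[OF b(1)] b(2)]) blast
  have G: "open {x. \<phi> x < 1/4}" "open {x. 3/4 < \<phi> x}"
    by (intro open_Collect_less continuous_intros \<phi>(1))+
  have sub: "cyclic_tracers f l r a \<subseteq> {x. \<phi> x < 1/4}" "cyclic_tracers f l r b \<subseteq> {x. 3/4 < \<phi> x}"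
    using \<phi>(4,5) by auto
  obtain R where R: "\<And>x j. j < l \<Longrightarrow>
      (\<And>i. i < R \<Longrightarrow> dist ((f ^^ i) x) ((f ^^ ((i + j) mod l)) a) \<le> r) \<Longrightarrow> x \<in> {x. \<phi> x < 1/4}"
    by (rule long_tracing_enters[OF comp cont G(1) sub(1)]) blast
  obtain R' where R': "\<And>x j. j < l \<Longrightarrow>
      (\<And>i. i < R' \<Longrightarrow> dist ((f ^^ i) x) ((f ^^ ((i + j) mod l)) b) \<le> r) \<Longrightarrow> x \<in> {x. 3/4 < \<phi> x}"
    by (rule long_tracing_enters[OF comp cont G(2) sub(2)]) blast
  \<comment> \<open>Large \<open>q\<close> means short runs, which lower the growth rate from \<open>h'\<close> to no less than \<open>h\<close>.\<close>
  obtain q where q_large: "2 * h' / (h' - h) < real q" using reals_Archimedean2 by blast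
  moreover have "0 < 2 * h' / (h' - h)" using h'(1) h'_pos by simp
  ultimately have q: "0 < q" "2 * h' / (h' - h) < real q" by auto
  have qh: "h \<le> h' * (1 - 2 / real q)"
    using q h' by (simp add: field_simps)
  define run where "run k i \<longleftrightarrow> q * 2 ^ k \<le> i \<and> i < (q + 1) * 2 ^ k" for k i :: nat
  have run_unique: "k = k'" if "run k i" "run k' i" for k k' i
    using run_index_unique[of q k i k'] that q(1) unfolding run_def by blast
  define S where "S i = (if \<exists>k. even k \<and> run k i then {a} else if \<exists>k. run k i then {b} else P)" for i
  have S: "S i \<subseteq> P" "finite (S i)" "S i \<noteq> {}" for i using a b P(1) by (auto simp: S_def)
  have "coded_set f l r S \<subseteq> irregular_set f"
  proof
    fix z assume z: "z \<in> coded_set f l r S"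
    have on_run: "dist ((f ^^ (i * l + j)) z) ((f ^^ j) (if even k then a else b)) \<le> r"
      if "run k i" "j < l" for k i j
    proof -
      have "S i = {if even k then a else b}"
      proof (cases "even k")
        case True
        then have "\<exists>k. even k \<and> run k i" using that(1) by blast
        then show ?thesis using True by (simp add: S_def)
      next
        case False
        then have "\<not> (\<exists>k. even k \<and> run k i)" using run_unique that(1) by blast
        then have "S i = (if \<exists>k. run k i then {b} else P)" unfolding S_def by (rule if_not_P)
        also have "\<dots> = {b}" using that(1) by (intro if_P) blast
        finally show ?thesis using False by simp
      qed
      moreover have "\<exists>p\<in>S i. \<forall>j<l. dist ((f ^^ (i * l + j)) z) ((f ^^ j) p) \<le> r"
        using z by (simp add: coded_set_def)
      ultimately show ?thesis using that(2) by simp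
    qed
    have "\<not> convergent (\<lambda>n. (\<Sum>i<n. \<phi> ((f ^^ i) z)) / real n)"
    proof
      assume "convergent (\<lambda>n. (\<Sum>i<n. \<phi> ((f ^^ i) z)) / real n)"
      then obtain t where lim: "(\<lambda>n. (\<Sum>i<n. \<phi> ((f ^^ i) z)) / real n) \<longlonglongrightarrow> t"
        by (auto simp: convergent_def)
      have "t \<le> 1/4"
      proof (rule limit_le_of_runs[OF lim \<phi>(3) _ l q(1), where p = a and R = R and r = r and K = "{k. even k}"])
        show "infinite {k::nat. even k}"
          unfolding infinite_nat_iff_unbounded_le by (metis dvd_triv_left le_add1 mem_Collect_eq mult_2)
        show "dist ((f ^^ (i * l + j)) z) ((f ^^ j) a) \<le> r"
          if "k \<in> {k. even k}" "q * 2 ^ k \<le> i" "i < (q + 1) * 2 ^ k" "j < l" for k i j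
          using on_run[of k i j] that by (simp add: run_def)
        show "\<phi> x \<le> 1/4"
          if "j < l" "\<And>i. i < R \<Longrightarrow> dist ((f ^^ i) x) ((f ^^ ((i + j) mod l)) a) \<le> r" for x j
          using R[of j x] that by simp
      qed simp
      moreover have "- t \<le> - (3/4)"
      proof (rule limit_le_of_runs[where \<phi> = "\<lambda>x. - \<phi> x" and p = b and R = R' and r = r and K = "{k. odd k}" and z = z and f = f, OF _ _ _ l q(1)])
        show "(\<lambda>n. (\<Sum>i<n. - \<phi> ((f ^^ i) z)) / real n) \<longlonglongrightarrow> - t"
          using tendsto_minus[OF lim] by (simp add: sum_negf)
        show "- \<phi> x \<le> 1" for x using \<phi>(2)[of x] by simp
        show "infinite {k::nat. odd k}"
          unfolding infinite_nat_iff_unbounded_le by (metis even_Suc le_SucI le_refl mem_Collect_eq)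
        show "dist ((f ^^ (i * l + j)) z) ((f ^^ j) b) \<le> r"
          if "k \<in> {k. odd k}" "q * 2 ^ k \<le> i" "i < (q + 1) * 2 ^ k" "j < l" for k i j
          using on_run[of k i j] that by (simp add: run_def)
        show "- \<phi> x \<le> - (3/4)"
          if "j < l" "\<And>i. i < R' \<Longrightarrow> dist ((f ^^ i) x) ((f ^^ ((i + j) mod l)) b) \<le> r" for x j
          using R'[of j x] that by simp
      qed simp
      ultimately show False by simp
    qed
    then show "z \<in> irregular_set f" using \<phi>(1) by (auto simp: irregular_set_def irregular_for_def)
  qed
  moreover have "exp (- h * real l) * exp (h * real u) \<le> (\<Prod>i<u div l. real (card (S i)))" for u
  proof (rule prod_free_choices_ge[OF q(1) h(1) qh l h'_pos N])
    show "real (card (S i)) = real (card P)" if "\<not> (\<exists>k. q * 2 ^ k \<le> i \<and> i < (q + 1) * 2 ^ k)" for i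
    proof -
      have no_run: "\<not> (\<exists>k. run k i)" using that unfolding run_def .
      then have "\<not> (\<exists>k. even k \<and> run k i)" by blast
      then have "S i = (if \<exists>k. run k i then {b} else P)" unfolding S_def by (rule if_not_P)
      also have "\<dots> = P" using no_run by (rule if_not_P)
      finally show ?thesis by simp
    qed
    show "1 \<le> real (card (S i))" for i
      using S[of i] by (simp add: Suc_leI card_gt_0_iff)
  qed
  ultimately have "ereal h \<le> htop_on_eps f (irregular_set f) r"
    by (intro htop_on_eps_ge[OF comp cont sep S trace]) auto
  then show thesis using that r by blast
qed

theorem theorem1p5:
  fixes f :: "'a::metric_space \<Rightarrow> 'a"
  assumes "compact (UNIV :: 'a set)"
    and "continuous_on UNIV f"
    and "has_shadowing f"
  shows "((htop f > 0 \<and> irregular_set f \<noteq> {} \<and> htop_on f (irregular_set f) = htop f) \<or>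
          (htop f = 0 \<and> irregular_set f = {})) \<and>
         \<not> ((htop f > 0 \<and> irregular_set f \<noteq> {} \<and> htop_on f (irregular_set f) = htop f) \<and>
            (htop f = 0 \<and> irregular_set f = {}))"
proof (cases "htop f = 0")
  case True
  then show ?thesis using htop_pos_of_irregular[OF assms(1,3)] by auto
next
  case False
  then have pos: "0 < htop f" using htop_nonneg[of f] by simp
  have "htop f \<le> htop_on f (irregular_set f)"
  proof (rule dense_le)
    fix x assume x: "x < htop f"
    obtain h where h: "max 0 x < ereal h" "ereal h < htop f"
      using ereal_dense2[of "max 0 x" "htop f"] x pos by auto
    then have "0 \<le> h" by simp
    then obtain r where r: "0 < r" "ereal h \<le> htop_on_eps f (irregular_set f) r"
      using irregular_entropy_ge[OF assms _ h(2)] by blast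
    have "x \<le> ereal h" using h(1) by (simp add: less_imp_le)
    also note r(2)
    also have "htop_on_eps f (irregular_set f) r \<le> htop_on f (irregular_set f)"
      unfolding htop_on_eq_SUP using r(1) by (intro SUP_upper) auto
    finally show "x \<le> htop_on f (irregular_set f)" .
  qed
  moreover have "htop_on f (irregular_set f) \<le> htop f"
    unfolding htop_on_eq_SUP by (intro SUP_least htop_on_eps_le_htop) auto
  ultimately have eq: "htop_on f (irregular_set f) = htop f" by (rule antisym[rotated])
  \<comment> \<open>The empty set is covered by no balls at all, so its entropy is below every real number.\<close>
  have "irregular_set f \<noteq> {}"
  proof
    assume empty: "irregular_set f = {}"
    obtain r where "ereal 0 \<le> htop_on_eps f {} r"
      using irregular_entropy_ge[OF assms order_refl] pos unfolding empty zero_ereal_def[symmetric] by metis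
    moreover have "bowen_C f {} (-1) r = 0"
    proof -
      have "bowen_C_n f {} (-1) n r \<le> (\<Sum>\<^sub>\<infinity>(u, x)\<in>{}. ennreal (exp (- (-1) * real u)))" for n
        unfolding bowen_C_n_def by (rule INF_lower2[of "{}"]) (auto simp: bowen_covers_def)
      then show ?thesis by (simp add: bowen_C_eq_SUP)
    qed
    then have "htop_on_eps f {} r \<le> ereal (-1)"
      unfolding htop_on_eps_def by (intro Inf_lower) auto
    ultimately have "ereal 0 \<le> ereal (-1)" by (rule order_trans)
    then show False by simp
  qed
  then show ?thesis using pos eq by auto
qed

end
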